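(* Let $n\ge 3$ and consider the Dynkin diagram of type $D_{n+1}$ with the automorphism $\vee$ exchanging $n$ and $n+1$. (1) The assignment $(s_{i_1}s_{i_2}\cdots s_{i_n})\vee\ \longmapsto\ \big[\prod_{k=0}^{n}(i_1\,i_2\cdots i_n)^{k\vee}\big]$ is a one-to-one correspondence between the set of twisted Coxeter elements of type $D_{n+1}$ and the set of twisted adapted classes of type $D_{n+1}$. (2) The number of commutation classes in the twisted adapted cluster point of type $D_{n+1}$ is $2^{n}$.
   Context: Fix $n\ge 3$. The Dynkin diagram $\Delta$ of type $D_{n+1}$ has index set $I=\{1,\dots,n+1\}$ and edges $i-(i+1)$ for $1\le i\le n-1$ together with $(n-1)-(n+1)$. Let $\alpha_i$, $s_i$ $(i\in I)$ be the simple roots and simple reflections, $W$ the Weyl group, $w_0$ its longest element (of length $n(n+1)$). Let $\vee:I\to I$ be the involution with $n^\vee=n+1$, $(n+1)^\vee=n$, $i^\vee=i$ for $i\le n-1$; it also denotes the linear map $\alpha_i\mapsto\alpha_{i^\vee}$. For a word $j_1\cdots j_m$ in $I$ put $(j_1\cdots j_m)^\vee=j_1^\vee\cdots j_m^\vee$, and let $(j_1\cdots j_m)^{k\vee}$ be the result of applying $\vee$ $k$ times; $\prod_{k=0}^n$ of words denotes concatenation in increasing order of $k$. A twisted Coxeter element is an element $w\vee\in W\vee$ where $w=s_{i_1}\cdots s_{i_n}$ and $i_1,\dots,i_n$ contains exactly one index from each $\vee$-orbit $\{1\},\dots,\{n-1\},\{n,n+1\}$ (in any order). Two reduced words are commutation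 equivalent if one is obtained from the other by repeatedly exchanging adjacent letters $i,j$ with $s_is_j=s_js_i$, $i\neq j$; $[\mathbf i]$ denotes the commutation class of $\mathbf i$. Let $*:I\to I$ be the involution with $w_0(\alpha_i)=-\alpha_{i^*}$. If $i_1 i_2\cdots i_\ell$ is a reduced word of $w_0$, then so are $i_2\cdots i_\ell\, i_1^*$ and $i_\ell^*\, i_1\cdots i_{\ell-1}$. Two commutation classes of reduced words of $w_0$ are reflection equivalent if one is obtained from the other by a finite sequence of the operations: replace $[i_1i_2\cdots i_\ell]$ by $[i_2\cdots i_\ell\, i_1^*]$ or by $[i_\ell^*\,i_1\cdots i_{\ell-1}]$ (where $i_1\cdots i_\ell$ may be any representative of the class). An $r$-cluster point is an equivalence class for reflection equivalence. The word $\prod_{k=0}^{n}(1\,2\cdots n)^{k\vee}$ is a reduced word of $w_0$; the $r$-cluster point of its commutation class is the twisted adapted cluster point of type $D_{n+1}$, and the commutation classes belonging to it are the twisted adapted classes of type $D_{n+1}$. *)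

theory Defs
  imports Complex_Main
begin

definition index_set :: "nat \<Rightarrow> nat set" where
  "index_set n = {1..n + 1}"

definition edge :: "nat \<Rightarrow> nat \<Rightarrow> nat \<Rightarrow> bool" where
  "edge n i j \<longleftrightarrow> {i, j} \<in> {{k, k + 1} | k. 1 \<le> k \<and> k \<le> n - 1} \<union> {{n - 1, n + 1}}"

definition cartan :: "nat \<Rightarrow> nat \<Rightarrow> nat \<Rightarrow> real" where
  "cartan n i j = (if i = j then 2 else if edge n i j then - 1 else 0)"

text \<open>A vector of the root space is given by its coordinates with respect to the simple roots.
  Coordinates outside the index set are inert: every map below fixes them, so the maps are the
  usual ones on the span of the simple roots, extended by the identity.\<close>

type_synonym root_vec = "nat \<Rightarrow> real"

definition simple_root :: "nat \<Rightarrow> root_vec" where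
  "simple_root i = (\<lambda>j. if j = i then 1 else 0)"

definition simple_reflection :: "nat \<Rightarrow> nat \<Rightarrow> root_vec \<Rightarrow> root_vec" where
  "simple_reflection n i v = v(i := v i - (\<Sum>j\<in>index_set n. cartan n i j * v j))"

definition word_prod :: "nat \<Rightarrow> nat list \<Rightarrow> root_vec \<Rightarrow> root_vec" where
  "word_prod n w = foldr (\<lambda>i g. simple_reflection n i \<circ> g) w id"

text \<open>The simple reflections are involutions, so the group they generate consists of the products
  of words.\<close>

definition weyl_group :: "nat \<Rightarrow> (root_vec \<Rightarrow> root_vec) set" where
  "weyl_group n = word_prod n ` lists (index_set n)"

definition weyl_length :: "nat \<Rightarrow> (root_vec \<Rightarrow> root_vec) \<Rightarrow> nat" where
  "weyl_length n g = (LEAST k. \<exists>w\<in>lists (index_set n). length w = k \<and> word_prod n w = g)"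

definition longest_element :: "nat \<Rightarrow> root_vec \<Rightarrow> root_vec" where
  "longest_element n =
     (THE g. g \<in> weyl_group n \<and> (\<forall>h\<in>weyl_group n. weyl_length n h \<le> weyl_length n g))"

definition reduced_words :: "nat \<Rightarrow> (root_vec \<Rightarrow> root_vec) \<Rightarrow> nat list set" where
  "reduced_words n g = {w \<in> lists (index_set n). word_prod n w = g \<and> length w = weyl_length n g}"

definition vee :: "nat \<Rightarrow> nat \<Rightarrow> nat" where
  "vee n i = (if i = n then n + 1 else if i = n + 1 then n else i)"

text \<open>Since \<^term>\<open>vee n\<close> is an involution, precomposing coordinates with it is the linear map
  sending the simple root of index \<open>i\<close> to that of index \<^term>\<open>vee n i\<close>.\<close>

definition vee_map :: "nat \<Rightarrow> root_vec \<Rightarrow> root_vec" where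
  "vee_map n v = v \<circ> vee n"

definition vee_orbits :: "nat \<Rightarrow> nat set set" where
  "vee_orbits n = {{i, vee n i} | i. i \<in> index_set n}"

definition twisted_coxeter_words :: "nat \<Rightarrow> nat list set" where
  "twisted_coxeter_words n =
     {w \<in> lists (index_set n). length w = n \<and> (\<forall>A\<in>vee_orbits n. \<exists>!k. k < length w \<and> w ! k \<in> A)}"

definition twisted_coxeter_elements :: "nat \<Rightarrow> (root_vec \<Rightarrow> root_vec) set" where
  "twisted_coxeter_elements n = {word_prod n w \<circ> vee_map n | w. w \<in> twisted_coxeter_words n}"

definition comm_step :: "nat \<Rightarrow> (nat list \<times> nat list) set" where
  "comm_step n = {(u @ [i, j] @ v, u @ [j, i] @ v) | u v i j.
     i \<noteq> j \<and> simple_reflection n i \<circ> simple_reflection n j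
             = simple_reflection n j \<circ> simple_reflection n i}"

text \<open>Commutations preserve the product and the length, so the class of a reduced word
  consists of reduced words.\<close>

definition comm_class :: "nat \<Rightarrow> nat list \<Rightarrow> nat list set" where
  "comm_class n w = (comm_step n)\<^sup>* `` {w}"

definition longest_comm_classes :: "nat \<Rightarrow> nat list set set" where
  "longest_comm_classes n = comm_class n ` reduced_words n (longest_element n)"

definition star :: "nat \<Rightarrow> nat \<Rightarrow> nat" where
  "star n i =
     (THE j. j \<in> index_set n \<and> longest_element n (simple_root i) = (\<lambda>k. - simple_root j k))"

definition reflection_step :: "nat \<Rightarrow> (nat list set \<times> nat list set) set" where
  "reflection_step n =
     {(comm_class n (i # w), comm_class n (w @ [star n i])) | i w.
        i # w \<in> reduced_words n (longest_element n)} \<union>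
     {(comm_class n (w @ [i]), comm_class n (star n i # w)) | i w.
        w @ [i] \<in> reduced_words n (longest_element n)}"

definition reflection_equiv :: "nat \<Rightarrow> (nat list set \<times> nat list set) set" where
  "reflection_equiv n =
     (reflection_step n)\<^sup>* \<inter> longest_comm_classes n \<times> longest_comm_classes n"

definition twisted_power_word :: "nat \<Rightarrow> nat list \<Rightarrow> nat list" where
  "twisted_power_word n w = concat (map (\<lambda>k. (map (vee n) ^^ k) w) [0..<n + 1])"

text \<open>The set of twisted adapted classes.\<close>

definition twisted_adapted_cluster_point :: "nat \<Rightarrow> nat list set set" where
  "twisted_adapted_cluster_point n =
     reflection_equiv n `` {comm_class n (twisted_power_word n [1..<n + 1])}"

end

theory Submission
  imports Defs "HOL-Combinatorics.Permutations"
begin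

text \<open>
  Read the word of a twisted Coxeter element as one period of an infinite word in which every period
  is the image of the preceding one under \<open>\<or>\<close>. The power word is a window of \<open>n + 1\<close> periods. The longest
  element acts on the simple roots as \<open>- \<or>\<^sup>n\<^sup>+\<^sup>1\<close>, so \<open>*\<close> is \<open>\<or>\<^sup>n\<^sup>+\<^sup>1\<close>, and moving a letter \<open>i\<close> from the front
  to the end as \<open>i\<^sup>*\<close> shifts the window by one letter: it turns the power word of \<open>i w\<close> into that of
  \<open>w i\<^sup>\<or>\<close>. A letter that commutations can bring to the front of a power word comes from the first period
  (\<open>power_word_rotate\<close>), so the classes of power words are closed under reflection. Conversely all
  words of twisted Coxeter elements are connected by such rotations and commutations
  (\<open>rotations_connect\<close>). Hence the cluster point consists of exactly the classes of power words.

  Commutation classes are separated by projections: two words are commutation equivalent if and only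
  if for all letters \<open>i\<close>, \<open>j\<close> that are equal or adjacent in the diagram they leave the same word after
  deletion of all other letters (\<open>swap_steps_iff_same_projections\<close>). Folding \<open>n + 1\<close> to \<open>n\<close> makes the
  word of a twisted Coxeter element a permutation of \<open>1, \<dots>, n\<close>, and its commutation class is given
  by the set of those \<open>k < n\<close> that precede \<open>k + 1\<close>, the ascents, together with the choice between \<open>n\<close>
  and \<open>n + 1\<close>. These data can be read off both from the beginning of the power word
  (\<open>ascents_from_blocks\<close>) and from the element itself (\<open>ascents_from_word_prod\<close>). So twisted
  Coxeter elements and classes of power words are both parametrised by the data, which proves the
  bijection, and there are \<open>2\<^sup>n\<^sup>-\<^sup>1 \<cdot> 2\<close> possible data.

  The longest element is found by realising the Weyl group as even signed permutations of \<open>n + 1\<close>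
  Euclidean coordinates. The length is the number of positive roots that take a negative value on the
  image of a regular dominant vector. The product of the power word of \<open>1 \<dots> n\<close> is \<open>- \<or>\<^sup>n\<^sup>+\<^sup>1\<close>, which makes all
  \<open>n (n + 1)\<close> positive roots negative, and it is the only element that does so.
\<close>

section \<open>Words up to commutation\<close>

text \<open>Here \<open>D\<close> is a dependence relation: two neighbouring letters may be exchanged when they are not in \<open>D\<close>.\<close>

definition swap_step :: "('a \<Rightarrow> 'a \<Rightarrow> bool) \<Rightarrow> ('a list \<times> 'a list) set" where
  "swap_step D = {(u @ [i, j] @ v, u @ [j, i] @ v) | u v i j. \<not> D i j}"

definition same_projections :: "('a \<Rightarrow> 'a \<Rightarrow> bool) \<Rightarrow> 'a list \<Rightarrow> 'a list \<Rightarrow> bool" where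
  "same_projections D u v \<longleftrightarrow>
     (\<forall>i j. D i j \<longrightarrow> filter (\<lambda>x. x = i \<or> x = j) u = filter (\<lambda>x. x = i \<or> x = j) v)"

lemma swap_stepI: "\<not> D i j \<Longrightarrow> (u @ i # j # v, u @ j # i # v) \<in> swap_step D"
  unfolding swap_step_def by auto

lemma swap_steps_Cons: "(u, v) \<in> (swap_step D)\<^sup>* \<Longrightarrow> (x # u, x # v) \<in> (swap_step D)\<^sup>*"
proof (induction rule: rtrancl_induct)
  case (step v w)
  then obtain a b i j where "v = a @ i # j # b" "w = a @ j # i # b" "\<not> D i j"
    unfolding swap_step_def by auto
  then have "(x # v, x # w) \<in> swap_step D"
    using swap_stepI[of D i j "x # a" b] by simp
  then show ?case using step.IH by simp
qed simp

lemma swap_steps_to_front: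
  "\<forall>y\<in>set a. \<not> D y x \<Longrightarrow> (a @ x # b, x # a @ b) \<in> (swap_step D)\<^sup>*"
proof (induction a)
  case (Cons y a)
  have "(y # a @ x # b, y # x # a @ b) \<in> (swap_step D)\<^sup>*"
    using Cons by (intro swap_steps_Cons) auto
  also have "(y # x # a @ b, x # y # a @ b) \<in> swap_step D"
    using swap_stepI[of D y x "[]"] Cons.prems by simp
  finally show ?case by simp
qed simp

lemma filter_pair_before_first:
  assumes "v = a @ x # b" "x \<notin> set a" "y \<in> set a"
  shows "\<exists>r. filter (\<lambda>z. z = x \<or> z = y) v = y # r"
proof -
  obtain a1 a2 where a: "a = a1 @ y # a2" "y \<notin> set a1"
    using assms(3) split_list_first by metis
  have "filter (\<lambda>z. z = x \<or> z = y) a1 = []"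
    using a assms(2) by (auto simp: filter_empty_conv)
  then show ?thesis using a assms(1) by simp
qed

lemma same_projections_Cons:
  "same_projections D (x # u) (x # v) \<longleftrightarrow> same_projections D u v"
  unfolding same_projections_def by auto

text \<open>If a letter \<open>y\<close> dependent on \<open>x\<close> preceded the first \<open>x\<close> of \<open>v\<close>, then \<open>y\<close> would come first in the
  projection of \<open>v\<close> to \<open>x\<close> and \<open>y\<close>, whereas \<open>x\<close> comes first in that of \<open>x # u\<close>.\<close>

lemma same_projections_front:
  assumes "reflp D" "symp D" "same_projections D (x # u) v"
  obtains a b where "v = a @ x # b" "x \<notin> set a" "\<forall>y\<in>set a. \<not> D y x"
proof -
  have "filter (\<lambda>z. z = x \<or> z = x) (x # u) = filter (\<lambda>z. z = x \<or> z = x) v"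
    using assms(1,3) unfolding same_projections_def reflp_def by blast
  then have "set (filter (\<lambda>z. z = x) (x # u)) = set (filter (\<lambda>z. z = x) v)" by simp
  then have "x \<in> set v" by auto
  then obtain a b where v: "v = a @ x # b" "x \<notin> set a"
    using split_list_first by metis
  have "\<not> D y x" if y: "y \<in> set a" for y
  proof
    assume "D y x"
    then have "D x y" using assms(2) by (auto dest: sympD)
    then have "filter (\<lambda>z. z = x \<or> z = y) (x # u) = filter (\<lambda>z. z = x \<or> z = y) v"
      using assms(3) unfolding same_projections_def by blast
    moreover obtain r where "filter (\<lambda>z. z = x \<or> z = y) v = y # r"
      using filter_pair_before_first[OF v y] by auto
    ultimately show False using y v by auto
  qed
  then show ?thesis using v that by blast
qed

lemma swap_step_same_projections:
  assumes "reflp D" "symp D" "(u, v) \<in> swap_step D"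
  shows "same_projections D u v"
proof -
  obtain a b i j where *: "u = a @ i # j # b" "v = a @ j # i # b" "\<not> D i j"
    using assms(3) unfolding swap_step_def by auto
  have "\<not> D j i" "i \<noteq> j" using * assms(1,2) by (auto dest: sympD reflpD)
  then show ?thesis using * unfolding same_projections_def by auto
qed

lemma swap_steps_same_projections:
  assumes "reflp D" "symp D" "(u, v) \<in> (swap_step D)\<^sup>*"
  shows "same_projections D u v"
  using assms(3)
proof (induction rule: rtrancl_induct)
  case (step v w)
  then show ?case
    using swap_step_same_projections[OF assms(1,2), of v w] unfolding same_projections_def by simp
qed (simp add: same_projections_def)

text \<open>The converse is the projection lemma for traces: the first letter \<open>x\<close> of \<open>u\<close> can be moved to the
  front of \<open>v\<close>, and cancelling it leaves words with equal projections again.\<close>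

lemma same_projections_swap_steps:
  assumes "reflp D" "symp D" "same_projections D u v"
  shows "(u, v) \<in> (swap_step D)\<^sup>*"
  using assms(3)
proof (induction u arbitrary: v)
  case Nil
  have "filter (\<lambda>z. z = x \<or> z = x) [] = filter (\<lambda>z. z = x \<or> z = x) v" for x
    using Nil assms(1) unfolding same_projections_def reflp_def by blast
  then have "filter (\<lambda>z. z = x \<or> z = x) v = []" for x by simp
  from this[of "hd v"] have "v = []" by (cases v) auto
  then show ?case by simp
next
  case (Cons x u)
  obtain a b where v: "v = a @ x # b" and ind: "\<forall>y\<in>set a. \<not> D y x"
    using same_projections_front[OF assms(1,2) Cons.prems] by metis
  have sv: "(v, x # a @ b) \<in> (swap_step D)\<^sup>*" using swap_steps_to_front[of a D x b] ind v by simp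
  then have "same_projections D (x # u) (x # a @ b)"
    using swap_steps_same_projections[OF assms(1,2) sv] Cons.prems
    unfolding same_projections_def by simp
  then have "(u, a @ b) \<in> (swap_step D)\<^sup>*"
    using Cons.IH same_projections_Cons[of D x u "a @ b"] by blast
  then have "(x # u, x # a @ b) \<in> (swap_step D)\<^sup>*" by (rule swap_steps_Cons)
  moreover have "sym (swap_step D)"
  proof (rule symI)
    fix p q assume "(p, q) \<in> swap_step D"
    then obtain a b i j where "p = a @ i # j # b" "q = a @ j # i # b" "\<not> D i j"
      unfolding swap_step_def by auto
    then show "(q, p) \<in> swap_step D"
      using swap_stepI[of D j i a b] assms(2) by (auto dest: sympD)
  qed
  then have "(x # a @ b, v) \<in> (swap_step D)\<^sup>*" using sv sym_rtrancl by (metis symD)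
  ultimately show ?case by simp
qed

theorem swap_steps_iff_same_projections:
  assumes "reflp D" "symp D"
  shows "(u, v) \<in> (swap_step D)\<^sup>* \<longleftrightarrow> same_projections D u v"
  using assms same_projections_swap_steps swap_steps_same_projections by blast

lemma filter_eq_distinct:
  "distinct p \<Longrightarrow> filter (\<lambda>x. x = i) p = (if i \<in> set p then [i] else [])"
  by (induction p) auto

lemma filter_pair_absent:
  "j \<notin> set p \<Longrightarrow> filter (\<lambda>x. x = i \<or> x = j) p = filter (\<lambda>x. x = i) p"
  by (intro filter_cong) auto

lemma filter_swap: "filter (\<lambda>x. x = j \<or> x = i) p = filter (\<lambda>x. x = i \<or> x = j) p"
  by (intro filter_cong) auto

lemma filter_filter_pair:
  "filter (\<lambda>x. x = i \<or> x = j) (filter P p) =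
    (if P i then if P j then filter (\<lambda>x. x = i \<or> x = j) p else filter (\<lambda>x. x = i) p
     else if P j then filter (\<lambda>x. x = j) p else [])"
  by (induction p) auto

lemma filter_pair_distinct:
  assumes "distinct p" "i \<in> set p" "j \<in> set p" "i \<noteq> j"
  shows "filter (\<lambda>x. x = i \<or> x = j) p = [i, j] \<or> filter (\<lambda>x. x = i \<or> x = j) p = [j, i]"
  using assms
proof (induction p)
  case (Cons x p)
  have "filter (\<lambda>x. x = i \<or> x = j) p = filter (\<lambda>x. x = i) p" if "x = j"
    using Cons.prems that by (intro filter_pair_absent) auto
  moreover have "filter (\<lambda>x. x = i \<or> x = j) p = filter (\<lambda>x. x = j) p" if "x = i"
    using Cons.prems that by (intro filter_cong) auto
  ultimately show ?case using Cons by (auto simp: filter_eq_distinct)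
qed simp

text \<open>With \<open>x = n - 1\<close>, \<open>y = n\<close> and \<open>z = n + 1\<close> the two equations compare the first two periods of power words,
  projected to the two edges between the branch node and the orbit of \<open>n\<close>. The flags \<open>b\<close> and \<open>c\<close> tell whether the first
  period contains \<open>n\<close> or \<open>n + 1\<close>, and \<open>t\<close> and \<open>u\<close> whether \<open>n - 1\<close> precedes that letter.\<close>

lemma branch_patterns:
  assumes "x \<noteq> y" "x \<noteq> z"
    and "(if b then if t then [x, y] else [y, x] else [x]) @
        (if b then [x] else if t then [x, y] else [y, x]) @ r =
      (if c then if u then [x, y] else [y, x] else [x]) @
        (if c then [x] else if u then [x, y] else [y, x]) @ s"
    and "(if b then [x] else if t then [x, z] else [z, x]) @
        (if b then if t then [x, z] else [z, x] else [x]) @ r' =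
      (if c then [x] else if u then [x, z] else [z, x]) @
        (if c then if u then [x, z] else [z, x] else [x]) @ s'"
  shows "b = c \<and> t = u"
  using assms by (cases b; cases c; cases t; cases u) simp_all

lemma filter_pair_split:
  assumes "distinct p" "p = a @ i # b" "j \<in> set p" "j \<noteq> i"
  shows "filter (\<lambda>x. x = i \<or> x = j) p = [i, j] \<longleftrightarrow> j \<in> set b"
    and "filter (\<lambda>x. x = j \<or> x = i) p = [j, i] \<longleftrightarrow> j \<notin> set b"
proof -
  have i: "i \<notin> set a" "i \<notin> set b" and d: "distinct a" "distinct b" using assms by auto
  have F: "filter (\<lambda>x. x = i \<or> x = j) c = (if j \<in> set c then [j] else [])"
    "filter (\<lambda>x. x = j \<or> x = i) c = (if j \<in> set c then [j] else [])"
    if "i \<notin> set c" "distinct c" for c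
  proof -
    have "filter (\<lambda>x. x = i \<or> x = j) c = filter (\<lambda>x. x = j) c"
      "filter (\<lambda>x. x = j \<or> x = i) c = filter (\<lambda>x. x = j) c"
      using that(1) by (auto intro!: filter_cong)
    then show "filter (\<lambda>x. x = i \<or> x = j) c = (if j \<in> set c then [j] else [])"
      "filter (\<lambda>x. x = j \<or> x = i) c = (if j \<in> set c then [j] else [])"
      using that(2) by (simp_all add: filter_eq_distinct)
  qed
  have "j \<in> set a \<longleftrightarrow> j \<notin> set b" using assms by auto
  then show "filter (\<lambda>x. x = i \<or> x = j) p = [i, j] \<longleftrightarrow> j \<in> set b"
    "filter (\<lambda>x. x = j \<or> x = i) p = [j, i] \<longleftrightarrow> j \<notin> set b"
    using F[of a] F[of b] i d assms(2,4) by auto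
qed

text \<open>By induction \<open>\<pi>\<close> fixes everything below \<open>a\<close>, so \<open>\<pi> a\<close> and the preimage of \<open>a\<close> are both at least \<open>a\<close>;
  monotonicity between \<open>a\<close> and this preimage gives the other inequality.\<close>

lemma monotone_permutation_id:
  assumes p: "\<pi> permutes {1..m::nat}"
    and mono: "\<And>a b. 1 \<le> a \<Longrightarrow> a < b \<Longrightarrow> b \<le> m \<Longrightarrow> \<pi> a \<le> \<pi> b"
    and a: "a \<in> {1..m}"
  shows "\<pi> a = a"
  using a
proof (induction a rule: less_induct)
  case (less a)
  have inj: "\<pi> x = \<pi> y \<Longrightarrow> x = y" for x y using permutes_inj[OF p] by (simp add: inj_eq)
  have in_im: "\<pi> x \<in> {1..m} \<longleftrightarrow> x \<in> {1..m}" for x using permutes_in_image[OF p] .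
  have ge: "a \<le> \<pi> a"
  proof (rule ccontr)
    assume "\<not> a \<le> \<pi> a"
    then have "\<pi> (\<pi> a) = \<pi> a" using less in_im[of a] by auto
    then show False using inj \<open>\<not> a \<le> \<pi> a\<close> by force
  qed
  obtain c where c: "\<pi> c = a" using permutes_surj[OF p] by (metis surjD)
  then have cm: "c \<in> {1..m}" using in_im[of c] less.prems by simp
  have "a \<le> c"
  proof (rule ccontr)
    assume "\<not> a \<le> c"
    then have "\<pi> c = c" using less.IH[of c] cm by simp
    then show False using c \<open>\<not> a \<le> c\<close> by simp
  qed
  then have "\<pi> a \<le> \<pi> c" using mono[of a c] less.prems cm by (cases "a = c") auto
  then show ?case using ge c by simp
qed

section \<open>Twisted Coxeter words and their power words\<close>

locale type_D =
  fixes n :: nat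
  assumes n3: "3 \<le> n"
begin

definition dep :: "nat \<Rightarrow> nat \<Rightarrow> bool" where
  "dep i j \<longleftrightarrow> i = j \<or> edge n i j"

abbreviation equiv_words :: "nat list \<Rightarrow> nat list \<Rightarrow> bool" (infix "\<approx>" 50) where
  "u \<approx> v \<equiv> same_projections dep u v"

lemma edge_iff:
  "edge n i j \<longleftrightarrow> (1 \<le> i \<and> i < n \<and> j = i + 1) \<or> (1 \<le> j \<and> j < n \<and> i = j + 1) \<or>
     (i = n - 1 \<and> j = n + 1) \<or> (i = n + 1 \<and> j = n - 1)"
  using n3 unfolding edge_def by (auto simp: doubleton_eq_iff)

lemma edge_sym: "edge n i j \<longleftrightarrow> edge n j i"
  unfolding edge_iff by auto

lemma edge_vee: "edge n (vee n i) (vee n j) \<longleftrightarrow> edge n i j"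
  unfolding edge_iff vee_def using n3 by auto

lemma vee_vee [simp]: "vee n (vee n i) = i"
  by (auto simp: vee_def)

lemma vee_eq_iff: "vee n i = j \<longleftrightarrow> i = vee n j"
  by (auto simp: vee_def)

lemma vee_in_index_set [simp]: "vee n i \<in> index_set n \<longleftrightarrow> i \<in> index_set n"
  using n3 by (auto simp: vee_def index_set_def)

lemma vee_funpow_involution [simp]: "(vee n ^^ k) ((vee n ^^ k) i) = i"
  by (induction k arbitrary: i) (simp_all add: funpow_swap1)

lemma vee_funpow_in_index_set [simp]: "(vee n ^^ k) i \<in> index_set n \<longleftrightarrow> i \<in> index_set n"
  by (induction k) simp_all

lemma dep_vee: "dep (vee n i) (vee n j) \<longleftrightarrow> dep i j"
  by (auto simp: dep_def edge_vee) (metis vee_vee)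

lemma dep_refl: "reflp dep"
  by (simp add: reflp_def dep_def)

lemma dep_sym: "symp dep"
  using edge_sym by (auto simp: symp_def dep_def)

lemma equiv_refl [simp]: "u \<approx> u"
  by (simp add: same_projections_def)

lemma equiv_sym: "u \<approx> v \<Longrightarrow> v \<approx> u"
  by (simp add: same_projections_def)

lemma equiv_trans: "u \<approx> v \<Longrightarrow> v \<approx> w \<Longrightarrow> u \<approx> w"
  by (simp add: same_projections_def)

lemma equiv_append: "u \<approx> v \<Longrightarrow> u' \<approx> v' \<Longrightarrow> u @ u' \<approx> v @ v'"
  by (simp add: same_projections_def)

lemma equiv_rev: "u \<approx> v \<Longrightarrow> rev u \<approx> rev v"
  by (simp add: same_projections_def flip: rev_filter)

lemma equiv_set: "u \<approx> v \<Longrightarrow> set u = set v"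
proof -
  assume "u \<approx> v"
  then have "filter (\<lambda>x. x = i \<or> x = i) u = filter (\<lambda>x. x = i \<or> x = i) v" for i
    unfolding same_projections_def dep_def by blast
  then have "set (filter (\<lambda>x. x = i \<or> x = i) u) = set (filter (\<lambda>x. x = i \<or> x = i) v)" for i
    by simp
  then show ?thesis by auto
qed

lemma equiv_to_front: "\<forall>y\<in>set a. \<not> dep y x \<Longrightarrow> a @ x # b \<approx> x # a @ b"
  using swap_steps_to_front swap_steps_same_projections[OF dep_refl dep_sym] by metis

lemma filter_map_vee:
  "filter (\<lambda>x. x = i \<or> x = j) (map (vee n) u) =
     map (vee n) (filter (\<lambda>x. x = vee n i \<or> x = vee n j) u)"
  by (simp add: filter_map o_def vee_eq_iff)

lemma equiv_vee: "u \<approx> v \<Longrightarrow> map (vee n) u \<approx> map (vee n) v"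
  unfolding same_projections_def filter_map_vee using dep_vee by metis

definition blocks :: "nat \<Rightarrow> nat list \<Rightarrow> nat list" where
  "blocks m w = concat (map (\<lambda>k. (map (vee n) ^^ k) w) [0..<m])"

lemma twisted_power_word_blocks: "twisted_power_word n w = blocks (n + 1) w"
  by (simp add: twisted_power_word_def blocks_def)

lemma map_vee_funpow: "(map (vee n) ^^ k) w = map (vee n ^^ k) w"
  by (induction k) simp_all

lemma blocks_0 [simp]: "blocks 0 w = []"
  by (simp add: blocks_def)

lemma blocks_Suc: "blocks (Suc m) w = blocks m w @ map (vee n ^^ m) w"
  by (simp add: blocks_def map_vee_funpow)

lemma blocks_Suc_front: "blocks (Suc m) w = w @ blocks m (map (vee n) w)"
proof (induction m)
  case 0
  then show ?case by (simp add: blocks_Suc)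
next
  case (Suc m)
  then show ?case
    by (subst blocks_Suc) (simp add: blocks_Suc[of m "map _ _"] funpow_swap1)
qed

text \<open>Shifting the window of the periodic word by one letter.\<close>

lemma blocks_rotate:
  "blocks m (i # w) @ [(vee n ^^ m) i] = i # blocks m (w @ [vee n i])"
proof (induction m)
  case (Suc m)
  have "blocks (Suc m) (i # w) @ [(vee n ^^ Suc m) i] =
      (blocks m (i # w) @ [(vee n ^^ m) i]) @ map (vee n ^^ m) w @ [(vee n ^^ Suc m) i]"
    by (simp add: blocks_Suc)
  also have "\<dots> = i # blocks (Suc m) (w @ [vee n i])"
    unfolding Suc by (simp add: blocks_Suc funpow_swap1)
  finally show ?case .
qed simp

text \<open>Reversed power words are again power words; this reduces moving a letter from the end to the front to
  the opposite move.\<close>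

lemma blocks_rev: "rev (blocks (Suc m) w) = blocks (Suc m) (rev (map (vee n ^^ m) w))"
proof (induction m arbitrary: w)
  case 0
  then show ?case by (simp add: blocks_Suc)
next
  case (Suc m)
  have "rev (blocks (Suc (Suc m)) w) = rev (blocks (Suc m) (map (vee n) w)) @ rev w"
    by (subst blocks_Suc_front) simp
  also have "\<dots> = blocks (Suc m) (rev (map (vee n ^^ Suc m) w)) @ rev w"
    unfolding Suc by (simp add: funpow_swap1 o_def rev_map)
  also have "rev w = map (vee n ^^ Suc m) (rev (map (vee n ^^ Suc m) w))"
    unfolding rev_map map_map o_def vee_funpow_involution by simp
  finally show ?case by (subst blocks_Suc)
qed

lemma equiv_blocks: "w \<approx> w' \<Longrightarrow> blocks m w \<approx> blocks m w'"
proof (induction m arbitrary: w w')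
  case (Suc m)
  show ?case
    unfolding blocks_Suc_front
    by (rule equiv_append[OF Suc.prems Suc.IH[OF equiv_vee[OF Suc.prems]]])
qed simp

lemma set_blocks: "set w \<subseteq> index_set n \<Longrightarrow> set (blocks m w) \<subseteq> index_set n"
  by (induction m) (auto simp: blocks_Suc)

lemma length_blocks: "length (blocks m w) = m * length w"
  by (induction m) (auto simp: blocks_Suc)

text \<open>Identifying the two letters of the orbit of \<open>n\<close> turns a twisted Coxeter word into a
  permutation of \<open>1, \<dots>, n\<close>.\<close>

definition fold_word :: "nat list \<Rightarrow> nat list" where
  "fold_word w = map (\<lambda>i. min i n) w"

definition perm_word :: "nat list \<Rightarrow> bool" where
  "perm_word p \<longleftrightarrow> distinct p \<and> set p = {1..n}"

definition unfold_word :: "bool \<Rightarrow> nat list \<Rightarrow> nat list" where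
  "unfold_word b p = (if b then p else map (vee n) p)"

definition twisted_word :: "nat list \<Rightarrow> bool" where
  "twisted_word w \<longleftrightarrow> set w \<subseteq> index_set n \<and> perm_word (fold_word w)"

definition ascents :: "nat list \<Rightarrow> nat set" where
  "ascents p = {k \<in> {1..<n}. filter (\<lambda>x. x = k \<or> x = k + 1) p = [k, k + 1]}"

lemma twisted_word_unfold: "perm_word p \<Longrightarrow> twisted_word (unfold_word b p)"
proof -
  assume p: "perm_word p"
  have "fold_word (unfold_word b p) = p"
    using p unfolding unfold_word_def fold_word_def perm_word_def
    by (auto intro!: map_idI simp: vee_def)
  moreover have "set (unfold_word b p) \<subseteq> index_set n"
    using p unfolding unfold_word_def perm_word_def index_set_def by (auto simp: vee_def)
  ultimately show ?thesis using p by (simp add: twisted_word_def)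
qed

lemma unfold_fold_word:
  assumes "twisted_word w"
  shows "w = unfold_word (n \<in> set w) (fold_word w)"
proof (cases "n \<in> set w")
  case True
  have "n + 1 \<notin> set w"
  proof
    assume "n + 1 \<in> set w"
    moreover have "inj_on (\<lambda>i. min i n) (set w)"
      using assms by (simp add: twisted_word_def fold_word_def perm_word_def distinct_map)
    ultimately show False using True inj_onD[of _ "set w" n "n + 1"] by force
  qed
  then have "i \<le> n" if "i \<in> set w" for i
    using assms that unfolding twisted_word_def index_set_def
    by (metis One_nat_def add_Suc_right atLeastAtMost_iff le_SucE subsetD add.right_neutral)
  then have "map (\<lambda>i. min i n) w = w" by (intro map_idI) simp
  then show ?thesis using True by (simp add: unfold_word_def fold_word_def)
next
  case False
  then have "map (\<lambda>i. vee n (min i n)) w = w"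
    using assms unfolding twisted_word_def index_set_def
    by (intro map_idI) (fastforce simp: vee_def min_def)
  then show ?thesis using False by (simp add: unfold_word_def fold_word_def o_def)
qed

lemma fold_word_vee: "set w \<subseteq> index_set n \<Longrightarrow> fold_word (map (vee n) w) = fold_word w"
  by (auto simp: fold_word_def vee_def index_set_def)

lemma twisted_word_vee: "twisted_word w \<Longrightarrow> twisted_word (map (vee n) w)"
  unfolding twisted_word_def using fold_word_vee by fastforce

lemma twisted_word_vee_funpow: "twisted_word w \<Longrightarrow> twisted_word (map (vee n ^^ k) w)"
  by (induction k) (use twisted_word_vee in \<open>fastforce simp flip: map_map\<close>)+

lemma twisted_word_rev: "twisted_word w \<Longrightarrow> twisted_word (rev w)"
  by (simp add: twisted_word_def fold_word_def perm_word_def flip: rev_map)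

lemma twisted_word_rotate:
  assumes "twisted_word (i # w)"
  shows "twisted_word (w @ [vee n i])"
proof -
  have "fold_word [vee n i] = fold_word [i]"
    using assms fold_word_vee[of "[i]"] by (simp add: twisted_word_def)
  then have "perm_word (fold_word (w @ [vee n i]))"
    using assms by (auto simp: twisted_word_def perm_word_def fold_word_def)
  then show ?thesis using assms by (simp add: twisted_word_def)
qed

lemma twisted_word_front: "twisted_word (a @ i # b) \<Longrightarrow> twisted_word (i # a @ b)"
  by (auto simp: twisted_word_def perm_word_def fold_word_def)

lemma twisted_word_set:
  assumes "twisted_word w"
  shows "set w = {1..<n} \<union> (if n \<in> set w then {n} else {n + 1})"
proof -
  have p: "set (fold_word w) = {1..n}" using assms by (simp add: twisted_word_def perm_word_def)
  have "vee n ` {1..n} = {1..<n} \<union> {n + 1}"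
    using n3 by (force simp: vee_def image_iff)
  then have "set (unfold_word (n \<in> set w) (fold_word w)) =
      {1..<n} \<union> (if n \<in> set w then {n} else {n + 1})"
    using p n3 by (auto simp: unfold_word_def)
  then show ?thesis using unfold_fold_word[OF assms] by metis
qed

lemma twisted_word_length: "twisted_word w \<Longrightarrow> length w = n"
  unfolding twisted_word_def perm_word_def fold_word_def
  by (metis card_atLeastAtMost diff_Suc_1 distinct_card length_map)

lemma twisted_word_iff: "w \<in> twisted_coxeter_words n \<longleftrightarrow> twisted_word w"
proof
  assume w: "w \<in> twisted_coxeter_words n"
  have len: "length w = n" and I: "set w \<subseteq> index_set n"
    and ex1: "\<And>A. A \<in> vee_orbits n \<Longrightarrow> \<exists>!k. k < length w \<and> w ! k \<in> A"
    using w by (auto simp: twisted_coxeter_words_def)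
  have dist: "distinct (fold_word w)"
    unfolding distinct_conv_nth
  proof (intro allI impI)
    fix k l assume kl: "k < length (fold_word w)" "l < length (fold_word w)" "k \<noteq> l"
    then have k: "k < length w" and l: "l < length w" by (auto simp: fold_word_def)
    have wk: "w ! k \<in> index_set n" and wl: "w ! l \<in> index_set n" using k l I by auto
    have A: "{w ! k, vee n (w ! k)} \<in> vee_orbits n" using wk by (auto simp: vee_orbits_def)
    show "fold_word w ! k \<noteq> fold_word w ! l"
    proof
      assume "fold_word w ! k = fold_word w ! l"
      then have "min (w ! k) n = min (w ! l) n" using k l by (simp add: fold_word_def)
      then have "w ! l \<in> {w ! k, vee n (w ! k)}"
        using wk wl by (auto simp: index_set_def vee_def min_def split: if_splits)
      then show False using ex1[OF A] k l kl(3) by blast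
    qed
  qed
  have "set (fold_word w) \<subseteq> {1..n}"
    using I n3 by (auto simp: fold_word_def index_set_def)
  moreover have "card (set (fold_word w)) = n"
    using dist len by (simp add: distinct_card) (simp add: fold_word_def)
  ultimately have "set (fold_word w) = {1..n}"
    by (intro card_subset_eq) auto
  then show "twisted_word w" using dist I by (simp add: twisted_word_def perm_word_def)
next
  assume w: "twisted_word w"
  have "\<exists>!k. k < length w \<and> w ! k \<in> A" if A: "A \<in> vee_orbits n" for A
  proof -
    obtain i where i: "i \<in> index_set n" "A = {i, vee n i}"
      using A by (auto simp: vee_orbits_def)
    have mem: "j \<in> A \<longleftrightarrow> min j n = min i n" if "j \<in> index_set n" for j
      using that i by (auto simp: index_set_def vee_def min_def split: if_splits)
    have wI: "w ! k \<in> index_set n" if "k < length w" for k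
      using w that by (auto simp: twisted_word_def)
    have "min i n \<in> set (fold_word w)"
      using w i n3 by (auto simp: twisted_word_def perm_word_def index_set_def)
    then obtain k where k: "k < length w" "min (w ! k) n = min i n"
      by (auto simp: fold_word_def in_set_conv_nth)
    have "l = k" if "l < length w" "min (w ! l) n = min i n" for l
    proof -
      have "fold_word w ! l = fold_word w ! k" using k that by (simp add: fold_word_def)
      moreover have "distinct (fold_word w)" using w by (simp add: twisted_word_def perm_word_def)
      ultimately show ?thesis
        using that k nth_eq_iff_index_eq[of "fold_word w" l k] by (simp add: fold_word_def)
    qed
    then show ?thesis using k mem wI by metis
  qed
  then show "w \<in> twisted_coxeter_words n"
    using w twisted_word_length by (auto simp: twisted_coxeter_words_def twisted_word_def)
qed

lemma perm_word_filter:
  assumes "perm_word p" "k \<in> {1..<n}"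
  shows "filter (\<lambda>x. x = k \<or> x = k + 1) p = (if k \<in> ascents p then [k, k + 1] else [k + 1, k])"
  using filter_pair_distinct[of p k "k + 1"] assms by (auto simp: perm_word_def ascents_def)

lemma perm_word_filter_last:
  assumes "perm_word p"
  shows "filter (\<lambda>x. x = n - 1 \<or> x = n) p = (if n - 1 \<in> ascents p then [n - 1, n] else [n, n - 1])"
  using perm_word_filter[OF assms, of "n - 1"] n3 by simp

lemma perm_word_filter_outer:
  assumes "perm_word p"
  shows "filter (\<lambda>x. x = n - 1 \<or> x = n + 1) p = [n - 1]"
proof -
  have "n + 1 \<notin> set p" "n - 1 \<in> set p" "distinct p" using assms n3 by (auto simp: perm_word_def)
  then show ?thesis by (simp add: filter_pair_absent filter_eq_distinct)
qed

text \<open>The only dependent pairs of distinct letters in a permutation of \<open>1, \<dots>, n\<close> are the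
  neighbours \<open>k, k + 1\<close>, whose order the ascents record.\<close>

lemma equiv_if_ascents_eq:
  assumes p: "perm_word p" and q: "perm_word q" and asc: "ascents p = ascents q"
  shows "p \<approx> q"
proof -
  have nb: "filter (\<lambda>x. x = k \<or> x = k + 1) p = filter (\<lambda>x. x = k \<or> x = k + 1) q"
    if "1 \<le> k" "k < n" for k
    using perm_word_filter[OF p, of k] perm_word_filter[OF q, of k] that asc by simp
  have out: "filter (\<lambda>x. x = n - 1 \<or> x = n + 1) p = filter (\<lambda>x. x = n - 1 \<or> x = n + 1) q"
    using perm_word_filter_outer p q by simp
  have eq: "filter (\<lambda>x. x = k \<or> x = k) p = filter (\<lambda>x. x = k \<or> x = k) q" for k
    using p q by (simp add: perm_word_def filter_eq_distinct)
  show ?thesis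
    unfolding same_projections_def
  proof (intro allI impI)
    fix i j assume "dep i j"
    then consider "i = j" | "1 \<le> i" "i < n" "j = i + 1" | "1 \<le> j" "j < n" "i = j + 1"
      | "i = n - 1" "j = n + 1" | "i = n + 1" "j = n - 1"
      unfolding dep_def edge_iff by blast
    then show "filter (\<lambda>x. x = i \<or> x = j) p = filter (\<lambda>x. x = i \<or> x = j) q"
    proof cases
      case 3
      then show ?thesis using nb[of j] filter_swap[of j i] by simp
    next
      case 5
      then show ?thesis using out filter_swap[of j i] by simp
    qed (use nb eq out in auto)
  qed
qed

lemma equiv_unfold: "p \<approx> q \<Longrightarrow> unfold_word b p \<approx> unfold_word b q"
  by (simp add: unfold_word_def equiv_vee)

text \<open>Equivalent power words have the same ascents and the same choice between \<open>n\<close> and \<open>n + 1\<close>. The order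
  of \<open>k\<close> and \<open>k + 1\<close> with \<open>k + 1 < n\<close> is visible in the first block. At the branch node, the projections
  to \<open>n - 1\<close> and either \<open>n\<close> or \<open>n + 1\<close> begin with three letters from the first two blocks. The pair
  of these beginnings is different for each of the four combinations of the choice and of the order of
  \<open>n - 1\<close> and the chosen letter.\<close>

lemma ascents_from_blocks:
  assumes p: "perm_word p" and q: "perm_word q"
    and eqv: "blocks (Suc (Suc m)) (unfold_word b p) \<approx> blocks (Suc (Suc m)) (unfold_word c q)"
  shows "b = c \<and> ascents p = ascents q"
proof -
  define P where "P i j = (\<lambda>r. filter (\<lambda>x. x = i \<or> x = j) (r :: nat list))" for i j
  have blocks2: "\<exists>r. blocks (Suc (Suc m)) w = w @ map (vee n) w @ r" for w
    by (metis blocks_Suc_front)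
  have eq: "\<exists>r s. P i j (unfold_word b p) @ P i j (map (vee n) (unfold_word b p)) @ r =
      P i j (unfold_word c q) @ P i j (map (vee n) (unfold_word c q)) @ s" if "dep i j" for i j
  proof -
    obtain r s where "blocks (Suc (Suc m)) (unfold_word b p) =
        unfold_word b p @ map (vee n) (unfold_word b p) @ r"
      "blocks (Suc (Suc m)) (unfold_word c q) =
        unfold_word c q @ map (vee n) (unfold_word c q) @ s"
      using blocks2 by meson
    moreover have "P i j (blocks (Suc (Suc m)) (unfold_word b p)) =
        P i j (blocks (Suc (Suc m)) (unfold_word c q))"
      using eqv that unfolding same_projections_def P_def by blast
    moreover have "P i j (u @ v) = P i j u @ P i j v" for u v
      by (simp add: P_def)
    ultimately show ?thesis by auto
  qed
  have vee_vee_map: "map (vee n) (map (vee n) r) = r" for r by (simp add: o_def)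
  have fixed: "P k (k + 1) (unfold_word b r) = P k (k + 1) r"
    if "perm_word r" "1 \<le> k" "k < n - 1" for r k b
    using perm_word_filter[OF that(1), of k] that
    by (auto simp: P_def unfold_word_def filter_map_vee vee_def)
  have low: "k \<in> ascents p \<longleftrightarrow> k \<in> ascents q" if k: "1 \<le> k" "k < n - 1" for k
  proof -
    have "dep k (k + 1)" using k by (auto simp: dep_def edge_iff)
    from eq[OF this] obtain r s where rs: "P k (k + 1) p @ r = P k (k + 1) q @ s"
      using fixed[OF p k] fixed[OF q k] by auto
    then show ?thesis
      using perm_word_filter[OF p, of k] perm_word_filter[OF q, of k] k
      by (auto simp: P_def split: if_splits)
  qed
  define o' where "o' r = (if n - 1 \<in> ascents r then [n - 1, n] else [n, n - 1])" for r
  have v: "vee n n = Suc n" "vee n (Suc n) = n" "vee n (n - Suc 0) = n - Suc 0"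
    using n3 by (auto simp: vee_def)
  have Pn: "P (n - 1) n (unfold_word b r) = (if b then o' r else [n - 1])"
    "P (n - 1) (n + 1) (unfold_word b r) = (if b then [n - 1] else map (vee n) (o' r))"
    "P (n - 1) n (map (vee n) (unfold_word b r)) = (if b then [n - 1] else o' r)"
    "P (n - 1) (n + 1) (map (vee n) (unfold_word b r)) = (if b then map (vee n) (o' r) else [n - 1])"
    if "perm_word r" for b r
    using perm_word_filter_last[OF that] perm_word_filter_outer[OF that]
    by (simp_all add: P_def unfold_word_def vee_vee_map o'_def filter_map_vee v del: map_map)
  have d: "dep (n - 1) n" "dep (n - 1) (n + 1)" using n3 by (auto simp: dep_def edge_iff)
  have "b = c \<and> (n - 1 \<in> ascents p \<longleftrightarrow> n - 1 \<in> ascents q)"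
  proof -
    have ov: "map (vee n) (o' r) = (if n - 1 \<in> ascents r then [n - 1, n + 1] else [n + 1, n - 1])" for r
      by (simp add: o'_def v)
    have ne: "n - 1 \<noteq> n" "n - 1 \<noteq> n + 1" using n3 by auto
    show ?thesis
      using eq[OF d(1)] eq[OF d(2)] branch_patterns[OF ne, of b "n - 1 \<in> ascents p" _ c "n - 1 \<in> ascents q"]
      unfolding Pn[OF p] Pn[OF q] ov unfolding o'_def by blast
  qed
  moreover have "ascents p = ascents q"
  proof (rule set_eqI)
    fix k
    consider "k \<notin> {1..<n}" | "1 \<le> k" "k < n - 1" | "k = n - 1" by force
    then show "k \<in> ascents p \<longleftrightarrow> k \<in> ascents q"
    proof cases
      case 1
      then show ?thesis by (auto simp: ascents_def)
    qed (use low calculation in auto)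
  qed
  ultimately show ?thesis by blast
qed

text \<open>Every set of ascents occurs: insert the letters in increasing order, each at the end or at
  the front.\<close>

fun word_with_ascents :: "nat set \<Rightarrow> nat \<Rightarrow> nat list" where
  "word_with_ascents S 0 = []"
| "word_with_ascents S (Suc m) =
    (if m \<in> S then word_with_ascents S m @ [Suc m] else Suc m # word_with_ascents S m)"

lemma word_with_ascents_distinct:
  "distinct (word_with_ascents S m) \<and> set (word_with_ascents S m) = {1..m}"
  by (induction m) auto

lemma word_with_ascents_filter:
  assumes "1 \<le> k" "k < m"
  shows "filter (\<lambda>x. x = k \<or> x = Suc k) (word_with_ascents S m) = (if k \<in> S then [k, Suc k] else [Suc k, k])"
  using assms(2)
proof (induction m)
  case (Suc m)
  have "filter (\<lambda>x. x = k \<or> x = Suc k) (word_with_ascents S m) = [k]" if "m = k"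
    using word_with_ascents_distinct[of S m] that assms(1)
    by (simp add: filter_pair_absent filter_eq_distinct)
  then show ?case using Suc by (cases "m = k") auto
qed simp

lemma perm_word_with_ascents: "perm_word (word_with_ascents S n)"
  using word_with_ascents_distinct by (simp add: perm_word_def)

lemma ascents_word_with_ascents: "S \<subseteq> {1..<n} \<Longrightarrow> ascents (word_with_ascents S n) = S"
  by (auto simp: ascents_def word_with_ascents_filter split: if_splits)

section \<open>Rotations of twisted Coxeter words\<close>

text \<open>A letter that can be brought to the front of the power word already occurs in the first block:
  the first letter \<open>n\<close> or \<open>n + 1\<close> of the second block is preceded by \<open>n - 1\<close>, on which it depends.
  So the word itself can be brought to the form \<open>i # w\<close>, and moving \<open>i\<close> to the end shifts the
  window of the infinite periodic word by one letter.\<close>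

lemma power_word_rotate:
  assumes w: "twisted_word w" and eqv: "i # u \<approx> blocks (Suc m) w"
  shows "\<exists>w'. twisted_word w' \<and> u @ [(vee n ^^ Suc m) i] \<approx> blocks (Suc m) w'"
proof -
  have front: "blocks (Suc m) w = w @ blocks m (map (vee n) w)" by (rule blocks_Suc_front)
  obtain a b where ab: "blocks (Suc m) w = a @ i # b" "i \<notin> set a" "\<forall>y\<in>set a. \<not> dep y i"
    using same_projections_front[OF dep_refl dep_sym eqv] by metis
  have I: "i \<in> index_set n"
    using set_blocks[of w "Suc m"] w ab(1) by (auto simp: twisted_word_def)
  have "i \<in> set w"
  proof (rule ccontr)
    assume i: "i \<notin> set w"
    then have "i = n \<or> i = n + 1" and "n - 1 \<in> set w"
      using twisted_word_set[OF w] I n3 by (auto simp: index_set_def split: if_splits)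
    then have "dep (n - 1) i" using n3 by (auto simp: dep_def edge_iff)
    moreover have "set w \<subseteq> set a"
    proof -
      have "w @ blocks m (map (vee n) w) = a @ i # b" using ab front by simp
      then have "\<exists>us. (w = a @ us \<and> us @ blocks m (map (vee n) w) = i # b) \<or>
          (w @ us = a \<and> blocks m (map (vee n) w) = us @ i # b)"
        by (rule append_eq_append_conv2[THEN iffD1])
      then obtain us where "(w = a @ us \<and> us @ blocks m (map (vee n) w) = i # b) \<or>
          (w @ us = a \<and> blocks m (map (vee n) w) = us @ i # b)"
        by blast
      then show ?thesis using i by (cases us) auto
    qed
    ultimately show False using ab(3) \<open>n - 1 \<in> set w\<close> by blast
  qed
  then obtain c d where cd: "w = c @ i # d" "i \<notin> set c" using split_list_first by metis
  have "c @ i # (d @ blocks m (map (vee n) w)) = a @ i # b" using cd front ab by simp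
  moreover have "takeWhile (\<lambda>x. x \<noteq> i) (e @ i # r) = e" if "i \<notin> set e" for e r
    using that by (induction e) auto
  ultimately have "c = a" using cd(2) ab(2) by metis
  then have "w \<approx> i # c @ d" using ab(3) cd equiv_to_front by blast
  then have "i # u \<approx> blocks (Suc m) (i # c @ d)" using eqv equiv_trans equiv_blocks by blast
  then have "(i # u) @ [(vee n ^^ Suc m) i] \<approx> blocks (Suc m) (i # c @ d) @ [(vee n ^^ Suc m) i]"
    by (rule equiv_append[OF _ equiv_refl])
  then have "i # u @ [(vee n ^^ Suc m) i] \<approx> i # blocks (Suc m) ((c @ d) @ [vee n i])"
    unfolding blocks_rotate append_Cons .
  then have "u @ [(vee n ^^ Suc m) i] \<approx> blocks (Suc m) ((c @ d) @ [vee n i])"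
    unfolding same_projections_Cons .
  moreover have "twisted_word ((c @ d) @ [vee n i])"
    using w cd twisted_word_front twisted_word_rotate by blast
  ultimately show ?thesis by blast
qed

text \<open>The mirror image of the preceding lemma, obtained by reversing all words.\<close>

lemma power_word_rotate_back:
  assumes w: "twisted_word w" and eqv: "u @ [i] \<approx> blocks (Suc m) w"
  shows "\<exists>w'. twisted_word w' \<and> (vee n ^^ Suc m) i # u \<approx> blocks (Suc m) w'"
proof -
  have "i # rev u \<approx> blocks (Suc m) (rev (map (vee n ^^ m) w))"
    using equiv_rev[OF eqv] blocks_rev by simp
  then obtain w' where w': "twisted_word w'" "rev u @ [(vee n ^^ Suc m) i] \<approx> blocks (Suc m) w'"
    using power_word_rotate twisted_word_rev twisted_word_vee_funpow w by blast
  have "(vee n ^^ Suc m) i # u \<approx> blocks (Suc m) (rev (map (vee n ^^ m) w'))"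
    using equiv_rev[OF w'(2)] blocks_rev by simp
  then show ?thesis using w'(1) twisted_word_rev twisted_word_vee_funpow by blast
qed

lemma rotate_segment:
  assumes Q_rotate: "\<And>i w. twisted_word (i # w) \<Longrightarrow> Q (i # w) \<Longrightarrow> Q (w @ [vee n i])"
    and "twisted_word (x @ y)" "Q (x @ y)"
  shows "Q (y @ map (vee n) x)"
  using assms(2,3)
proof (induction x arbitrary: y)
  case (Cons i x)
  have "twisted_word (x @ (y @ [vee n i]))" "Q (x @ (y @ [vee n i]))"
    using Q_rotate[of i "x @ y"] twisted_word_rotate[of i "x @ y"] Cons.prems by simp_all
  from Cons.IH[OF this] show ?case by simp
qed simp

text \<open>If \<open>k + 1\<close> precedes \<open>k\<close>, the letters above \<open>k\<close> can be collected in front of the others.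
  Such a word is reached from the one with the two parts exchanged by rotating the letters up
  to \<open>k\<close>; this changes the order of \<open>k\<close> and \<open>k + 1\<close> only.\<close>

theorem rotations_connect:
  assumes Q_rotate: "\<And>i w. twisted_word (i # w) \<Longrightarrow> Q (i # w) \<Longrightarrow> Q (w @ [vee n i])"
    and Q_equiv: "\<And>w w'. twisted_word w \<Longrightarrow> twisted_word w' \<Longrightarrow> w \<approx> w' \<Longrightarrow> Q w \<Longrightarrow> Q w'"
    and start: "Q [1..<n + 1]"
    and w: "twisted_word w"
  shows "Q w"
proof -
  have rotate: "Q (y @ map (vee n) x)" if "twisted_word (x @ y)" "Q (x @ y)" for x y
    using rotate_segment[of Q x y] Q_rotate that by blast
  have "Q (unfold_word b p)" if "perm_word p" for b p
    using that
  proof (induction "card ({1..<n} - ascents p)" arbitrary: p rule: less_induct)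
    case less
    show ?case
    proof (cases "ascents p = {1..<n}")
      case True
      have pw: "perm_word [1..<n + 1]" by (auto simp: perm_word_def)
      have "filter (\<lambda>x. x = k \<or> x = k + 1) [1..<n + 1] = [k, k + 1]" if "k \<in> {1..<n}" for k
      proof -
        have "[1..<n + 1] = [1..<k] @ k # (k + 1) # [k + 2..<n + 1]"
          using that upt_add_eq_append[of 1 k "n + 1 - k"] by (simp add: upt_conv_Cons)
        then show ?thesis by (simp only:) (auto simp: filter_empty_conv simp del: upt_Suc)
      qed
      then have "ascents [1..<n + 1] = {1..<n}"
        unfolding ascents_def by (auto simp del: upt_Suc)
      then have eq: "[1..<n + 1] \<approx> p" using equiv_if_ascents_eq pw less.prems True by blast
      have tw: "twisted_word [1..<n + 1]"
        using twisted_word_unfold[OF pw, of True] by (simp add: unfold_word_def)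
      have "Q (map (vee n) [1..<n + 1])"
        using start rotate[of "[1..<n + 1]" "[]"] tw by (simp del: upt_Suc)
      then have "Q (unfold_word b [1..<n + 1])"
        using start by (simp add: unfold_word_def del: upt_Suc)
      then show ?thesis
        using Q_equiv[OF _ _ equiv_unfold[OF eq]] twisted_word_unfold pw less.prems by blast
    next
      case False
      moreover have "ascents p \<subseteq> {1..<n}" by (auto simp: ascents_def)
      ultimately obtain k where k: "k \<in> {1..<n}" "k \<notin> ascents p" by blast
      define x where "x = filter (\<lambda>i. i \<le> k) p"
      define y where "y = filter (\<lambda>i. \<not> i \<le> k) p"
      have dp: "distinct p" "set p = {1..n}" using less.prems by (auto simp: perm_word_def)
      have "set (x @ y) = set p" "set (y @ x) = set p"
        unfolding x_def y_def by auto
      moreover have "distinct (x @ y)" "distinct (y @ x)"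
        unfolding x_def y_def using dp(1) by auto
      ultimately have xy: "perm_word (x @ y)" and yx: "perm_word (y @ x)"
        using dp(2) unfolding perm_word_def by blast+
      have F: "filter (\<lambda>x. x = l \<or> x = l + 1) x @ filter (\<lambda>x. x = l \<or> x = l + 1) y =
          (if l = k then [k, k + 1] else filter (\<lambda>x. x = l \<or> x = l + 1) p)"
        "filter (\<lambda>x. x = l \<or> x = l + 1) y @ filter (\<lambda>x. x = l \<or> x = l + 1) x =
          (if l = k then [k + 1, k] else filter (\<lambda>x. x = l \<or> x = l + 1) p)"
        if "l \<in> {1..<n}" for l
      proof -
        have single: "filter (\<lambda>x. x = k) p = [k]" "filter (\<lambda>x. x = k + 1) p = [k + 1]"
          using dp k(1) by (simp_all add: filter_eq_distinct)
        consider "l < k" | "l = k" | "k < l" by linarith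
        note cases = this
        show "filter (\<lambda>x. x = l \<or> x = l + 1) x @ filter (\<lambda>x. x = l \<or> x = l + 1) y =
          (if l = k then [k, k + 1] else filter (\<lambda>x. x = l \<or> x = l + 1) p)"
          unfolding x_def y_def filter_filter_pair using single by (cases rule: cases) simp_all
        show "filter (\<lambda>x. x = l \<or> x = l + 1) y @ filter (\<lambda>x. x = l \<or> x = l + 1) x =
          (if l = k then [k + 1, k] else filter (\<lambda>x. x = l \<or> x = l + 1) p)"
          unfolding x_def y_def filter_filter_pair using single by (cases rule: cases) simp_all
      qed
      have asc_xy: "ascents (x @ y) = insert k (ascents p)"
      proof (rule set_eqI)
        fix l show "l \<in> ascents (x @ y) \<longleftrightarrow> l \<in> insert k (ascents p)"
          using F(1)[of l] k by (cases "l \<in> {1..<n}") (auto simp: ascents_def)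
      qed
      have asc_yx: "ascents (y @ x) = ascents p"
      proof (rule set_eqI)
        fix l show "l \<in> ascents (y @ x) \<longleftrightarrow> l \<in> ascents p"
          using F(2)[of l] k by (cases "l \<in> {1..<n}") (auto simp: ascents_def)
      qed
      have "{1..<n} - ascents (x @ y) \<subset> {1..<n} - ascents p"
        using k unfolding asc_xy by blast
      then have "card ({1..<n} - ascents (x @ y)) < card ({1..<n} - ascents p)"
        by (intro psubset_card_mono) auto
      then have "Q (unfold_word b (x @ y))" using less.hyps xy by blast
      moreover have app: "unfold_word b (u @ v) = unfold_word b u @ unfold_word b v" for u v
        by (simp add: unfold_word_def)
      moreover have "map (vee n) (unfold_word b x) = unfold_word b x"
      proof -
        have "map (vee n) x = x"
          using k(1) by (intro map_idI) (auto simp: x_def vee_def)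
        then show ?thesis by (simp add: unfold_word_def)
      qed
      ultimately have "Q (unfold_word b (y @ x))"
        using rotate[of "unfold_word b x" "unfold_word b y"]
          twisted_word_unfold[OF xy, of b] by simp
      moreover have "y @ x \<approx> p"
        using equiv_if_ascents_eq[OF yx less.prems asc_yx] .
      ultimately show ?thesis
        using Q_equiv[OF _ _ equiv_unfold] twisted_word_unfold yx less.prems by blast
    qed
  qed
  then show ?thesis using unfold_fold_word[OF w] w by (metis twisted_word_def)
qed

section \<open>The Weyl group as a group of signed permutations\<close>

lemma simple_reflection_neighbours:
  assumes "i \<in> index_set n"
  shows "simple_reflection n i v = v(i := (\<Sum>j | j \<in> index_set n \<and> edge n i j. v j) - v i)"
proof -
  have fin: "finite (index_set n)" by (simp add: index_set_def)
  have irr: "\<not> edge n i i" unfolding edge_iff using n3 by auto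
  have "(\<Sum>j\<in>index_set n. cartan n i j * v j) =
      (\<Sum>j\<in>index_set n. (if j = i then 2 * v i else 0) - (if edge n i j then v j else 0))"
    using irr by (intro sum.cong) (auto simp: cartan_def)
  also have "\<dots> = 2 * v i - (\<Sum>j | j \<in> index_set n \<and> edge n i j. v j)"
    using assms fin by (simp add: sum_subtractf sum.inter_filter)
  finally show ?thesis by (simp add: simple_reflection_def)
qed

lemma neighbours:
  assumes "i \<in> index_set n"
  shows "{j. j \<in> index_set n \<and> edge n i j} =
    (if i = 1 then {2} else if i < n - 1 then {i - 1, i + 1}
     else if i = n - 1 then {n - 2, n, n + 1} else {n - 1})"
proof -
  obtain m where m: "n = m + 3" using n3 by (metis add.commute le_Suc_ex)
  show ?thesis using assms unfolding edge_iff index_set_def unfolding m by (auto split: if_splits)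
qed

text \<open>The coordinates of a vector with respect to an orthonormal basis \<open>e\<^sub>1, \<dots>, e\<^sub>n\<^sub>+\<^sub>1\<close> in which the
  simple roots are \<open>e\<^sub>i - e\<^sub>i\<^sub>+\<^sub>1\<close> for \<open>i \<le> n\<close> and \<open>e\<^sub>n + e\<^sub>n\<^sub>+\<^sub>1\<close>.\<close>

definition euclid :: "root_vec \<Rightarrow> nat \<Rightarrow> real" where
  "euclid v a =
    (if a = 1 then v 1 else if 1 < a \<and> a < n then v a - v (a - 1)
     else if a = n then v n + v (n + 1) - v (n - 1)
     else if a = n + 1 then v (n + 1) - v n else v a)"

definition signed_swap :: "nat \<Rightarrow> (nat \<Rightarrow> real) \<Rightarrow> nat \<Rightarrow> real" where
  "signed_swap i y =
    (if i = n + 1 then y(n := - y (n + 1), n + 1 := - y n) else y(i := y (i + 1), i + 1 := y i))"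

definition act :: "nat list \<Rightarrow> (nat \<Rightarrow> real) \<Rightarrow> nat \<Rightarrow> real" where
  "act w = foldr signed_swap w"

lemma act_simps [simp]:
  "act [] y = y" "act (i # w) y = signed_swap i (act w y)" "act (u @ w) y = act u (act w y)"
  by (simp_all add: act_def)

lemma euclid_reflection:
  assumes "i \<in> index_set n"
  shows "euclid (simple_reflection n i v) = signed_swap i (euclid v)"
proof
  fix a
  have sum: "(\<Sum>j | j \<in> index_set n \<and> edge n i j. v j) =
    (if i = 1 then v 2 else if i < n - 1 then v (i - 1) + v (i + 1)
     else if i = n - 1 then v (n - 2) + v n + v (n + 1) else v (n - 1))"
  proof -
    have "n - 2 \<noteq> n" "n - 2 \<noteq> n + 1" "i - 1 \<noteq> i + 1" using n3 by auto
    then show ?thesis unfolding neighbours[OF assms] by simp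
  qed
  note eq = simple_reflection_neighbours[OF assms, of v, unfolded sum]
  consider "i = 1" | "1 < i" "i < n - 1" | "i = n - 1" | "i = n" | "i = n + 1"
    using assms by (force simp: index_set_def)
  then show "euclid (simple_reflection n i v) a = signed_swap i (euclid v) a"
  proof cases
    case 1
    then show ?thesis using n3 unfolding eq euclid_def signed_swap_def by (auto simp: numeral_2_eq_2)
  next
    case 2
    consider "a = i" | "a = i + 1" | "a \<noteq> i" "a \<noteq> i + 1" "a - 1 \<noteq> i" | "a = 0" by linarith
    moreover have "i < n" "i + 1 < n" "i - 1 \<noteq> i" "i \<noteq> n" "i \<noteq> n + 1" "i \<noteq> n - 1"
      using 2 by auto
    ultimately show ?thesis
      using 2 n3 unfolding eq euclid_def signed_swap_def by cases simp_all
  next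
    case 3
    obtain m where m: "n = m + 3" using n3 by (metis add.commute le_Suc_ex)
    consider "a = 0" | "a = 1" | "1 < a" "a < m + 2" "a - 1 \<noteq> m + 2" | "a = m + 2" | "a = m + 3" | "a = m + 4" | "m + 4 < a"
      by linarith
    then show ?thesis
      unfolding eq euclid_def signed_swap_def unfolding 3 unfolding m by cases simp_all
  next
    case 4
    then show ?thesis using n3 unfolding eq euclid_def signed_swap_def by auto
  next
    case 5
    then show ?thesis using n3 unfolding eq euclid_def signed_swap_def by auto
  qed
qed

lemma word_prod_simps [simp]:
  "word_prod n [] = id"
  "word_prod n (i # w) = simple_reflection n i \<circ> word_prod n w"
  by (simp_all add: word_prod_def)

lemma word_prod_append: "word_prod n (u @ w) = word_prod n u \<circ> word_prod n w"
  by (induction u) (simp_all add: o_assoc)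

lemma euclid_word_prod: "set w \<subseteq> index_set n \<Longrightarrow> euclid (word_prod n w v) = act w (euclid v)"
  by (induction w) (simp_all add: euclid_reflection)

lemma euclid_inj: "euclid u = euclid v \<Longrightarrow> u = v"
proof
  fix a
  assume eq: "euclid u = euclid v"
  have low: "u a = v a" if "1 \<le> a" "a < n" for a
    using that
  proof (induction a rule: dec_induct)
    case base
    then show ?case using fun_cong[OF eq, of 1] by (simp add: euclid_def)
  next
    case (step m)
    then show ?case using fun_cong[OF eq, of "Suc m"] by (simp add: euclid_def)
  qed
  consider "1 \<le> a" "a < n" | "a = n \<or> a = n + 1" | "a = 0 \<or> a > n + 1" by linarith
  then show "u a = v a"
  proof cases
    case 2
    then show ?thesis
      using fun_cong[OF eq, of n] fun_cong[OF eq, of "n + 1"] low[of "n - 1"] n3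
      by (auto simp: euclid_def)
  next
    case 3
    then show ?thesis using fun_cong[OF eq, of a] n3 by (auto simp: euclid_def)
  qed (use low in auto)
qed

lemma reflection_involution:
  "i \<in> index_set n \<Longrightarrow> simple_reflection n i \<circ> simple_reflection n i = id"
proof
  fix v
  assume i: "i \<in> index_set n"
  have "euclid (simple_reflection n i (simple_reflection n i v)) = euclid v"
    using n3 unfolding euclid_reflection[OF i] by (auto simp: signed_swap_def fun_eq_iff)
  then show "(simple_reflection n i \<circ> simple_reflection n i) v = id v"
    using euclid_inj by simp
qed

text \<open>The positive roots \<open>e\<^sub>a + e\<^sub>b\<close> and \<open>e\<^sub>a - e\<^sub>b\<close> with \<open>a < b\<close>, coded by \<open>(a, b, True)\<close> and
  \<open>(a, b, False)\<close>, and their values on a vector.\<close>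

definition pos_roots :: "(nat \<times> nat \<times> bool) set" where
  "pos_roots = {(a, b, s). 1 \<le> a \<and> a < b \<and> b \<le> n + 1}"

definition root_value :: "(nat \<Rightarrow> real) \<Rightarrow> nat \<times> nat \<times> bool \<Rightarrow> real" where
  "root_value y = (\<lambda>(a, b, s). if s then y a + y b else y a - y b)"

definition simple :: "nat \<Rightarrow> nat \<times> nat \<times> bool" where
  "simple i = (if i = n + 1 then (n, n + 1, True) else (i, i + 1, False))"

definition negative_roots :: "(nat \<Rightarrow> real) \<Rightarrow> (nat \<times> nat \<times> bool) set" where
  "negative_roots y = {r \<in> pos_roots. root_value y r < 0}"

text \<open>The permutation that the \<open>i\<close>-th simple reflection induces on the positive roots other than
  the \<open>i\<close>-th simple root.\<close>

definition permute_root :: "nat \<Rightarrow> nat \<times> nat \<times> bool \<Rightarrow> nat \<times> nat \<times> bool" where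
  "permute_root i = (\<lambda>(a, b, s).
    if i = n + 1 then
      if a < n \<and> n \<le> b then (a, if b = n then n + 1 else n, \<not> s) else (a, b, s)
    else if a = i \<and> b = i + 1 then (a, b, s)
    else (transpose i (i + 1) a, transpose i (i + 1) b, s))"

lemma simple_in_pos_roots: "i \<in> index_set n \<Longrightarrow> simple i \<in> pos_roots"
  using n3 by (auto simp: simple_def pos_roots_def index_set_def)

lemma permute_root_in:
  assumes "i \<in> index_set n" "r \<in> pos_roots - {simple i}"
  shows "permute_root i r \<in> pos_roots - {simple i}"
  using assms
  by (cases r) (auto simp: pos_roots_def simple_def permute_root_def index_set_def transpose_def
      split: if_splits)

lemma permute_root_involution:
  assumes "i \<in> index_set n" "r \<in> pos_roots - {simple i}"
  shows "permute_root i (permute_root i r) = r"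
  using assms
  by (cases r) (auto simp: pos_roots_def simple_def permute_root_def index_set_def transpose_def
      split: if_splits)

lemma root_value_permute:
  assumes "i \<in> index_set n" "r \<in> pos_roots - {simple i}"
  shows "root_value (signed_swap i y) r = root_value y (permute_root i r)"
proof -
  obtain a b s where r: "r = (a, b, s)" by (cases r)
  have "a < n \<or> a = n \<and> b = n + 1" using assms(2) r by (auto simp: pos_roots_def)
  then show ?thesis
    using assms unfolding r
    by (auto simp: pos_roots_def simple_def permute_root_def index_set_def transpose_def
        root_value_def signed_swap_def split: if_splits)
qed

lemma root_value_simple:
  "i \<in> index_set n \<Longrightarrow> root_value (signed_swap i y) (simple i) = - root_value y (simple i)"
  by (auto simp: root_value_def signed_swap_def simple_def index_set_def)

lemma finite_pos_roots: "finite pos_roots"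
proof (rule finite_subset)
  show "pos_roots \<subseteq> {..n + 1} \<times> {..n + 1} \<times> UNIV" by (auto simp: pos_roots_def)
qed auto

lemma card_pos_roots: "card pos_roots = n * (n + 1)"
proof -
  have eq: "pos_roots = (SIGMA a:{1..n + 1}. {a<..n + 1} \<times> UNIV)" by (auto simp: pos_roots_def)
  have "card pos_roots = (\<Sum>a\<in>{1..n + 1}. 2 * (n + 1 - a))"
    unfolding eq by (subst card_SigmaI) (auto simp: card_cartesian_product mult.commute)
  also have "\<dots> = n * (n + 1)"
  proof -
    have "(\<Sum>a\<in>{1..m + 1}. 2 * (m + 1 - a)) = m * (m + 1)" for m :: nat
    proof -
      have "(\<Sum>a\<in>{1..m + 1}. 2 * (m + 1 - a)) = (\<Sum>a\<in>{..m}. 2 * a)"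
        by (rule sum.reindex_bij_witness[of _ "\<lambda>a. m + 1 - a" "\<lambda>a. m + 1 - a"]) auto
      also have "\<dots> = m * (m + 1)" by (induction m) (auto simp: algebra_simps)
      finally show ?thesis .
    qed
    then show ?thesis .
  qed
  finally show ?thesis .
qed

text \<open>A simple reflection permutes the positive roots other than its own and negates that one, so it
  changes the number of negative values by at most one.\<close>

lemma card_negative_roots_swap_eq:
  assumes i: "i \<in> index_set n"
  shows "card (negative_roots (signed_swap i y) - {simple i}) = card (negative_roots y - {simple i})"
proof (rule bij_betw_same_card)
  show "bij_betw (permute_root i) (negative_roots (signed_swap i y) - {simple i})
      (negative_roots y - {simple i})"
  proof (rule bij_betw_byWitness[where f' = "permute_root i"])
    show "permute_root i ` (negative_roots (signed_swap i y) - {simple i}) \<subseteq> negative_roots y - {simple i}"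
      using permute_root_in[OF i] root_value_permute[OF i, of _ y]
      by (fastforce simp: negative_roots_def)
    show "permute_root i ` (negative_roots y - {simple i}) \<subseteq> negative_roots (signed_swap i y) - {simple i}"
      using permute_root_in[OF i] root_value_permute[OF i, of "permute_root i _" y]
        permute_root_involution[OF i]
      by (fastforce simp: negative_roots_def)
  qed (use permute_root_involution[OF i] in \<open>auto simp: negative_roots_def\<close>)
qed

lemma finite_negative_roots: "finite (negative_roots y)"
  using finite_pos_roots by (simp add: negative_roots_def)

lemma card_negative_roots_swap_le:
  assumes i: "i \<in> index_set n"
  shows "card (negative_roots (signed_swap i y)) \<le> card (negative_roots y) + 1"
proof -
  have "card (negative_roots (signed_swap i y)) \<le> card (negative_roots (signed_swap i y) - {simple i}) + 1"
    using finite_negative_roots by (metis card_Diff_singleton_if diff_le_self le_diff_conv order_refl add.commute trans_le_add2)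
  also have "\<dots> \<le> card (negative_roots y) + 1"
    unfolding card_negative_roots_swap_eq[OF i]
    using finite_negative_roots by (simp add: card_Diff1_le)
  finally show ?thesis .
qed

lemma card_negative_roots_swap_less:
  assumes i: "i \<in> index_set n" and neg: "root_value y (simple i) < 0"
  shows "card (negative_roots y) = card (negative_roots (signed_swap i y)) + 1"
proof -
  have "simple i \<in> negative_roots y" "simple i \<notin> negative_roots (signed_swap i y)"
    using neg simple_in_pos_roots[OF i] root_value_simple[OF i] by (auto simp: negative_roots_def)
  then show ?thesis
    using card_negative_roots_swap_eq[OF i, of y] finite_negative_roots
      card_Suc_Diff1[of "negative_roots y" "simple i"] by simp
qed

lemma card_negative_roots_act:
  "set w \<subseteq> index_set n \<Longrightarrow> card (negative_roots (act w y)) \<le> length w + card (negative_roots y)"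
proof (induction w)
  case (Cons i w)
  then show ?case using card_negative_roots_swap_le[of i "act w y"] by simp
qed simp

text \<open>A positive root is a sum of simple roots, so it is nonnegative where these are.\<close>

lemma negative_simple_root:
  assumes "negative_roots y \<noteq> {}"
  obtains i where "i \<in> index_set n" "root_value y (simple i) < 0"
proof (rule ccontr)
  assume "\<not> thesis"
  then have nonneg: "root_value y (simple i) \<ge> 0" if "i \<in> index_set n" for i
    using that \<open>\<And>i. _ i \<Longrightarrow> _ i \<Longrightarrow> thesis\<close> by fastforce
  have descend: "y (Suc a) \<le> y a" if "1 \<le> a" "a \<le> n" for a
    using nonneg[of a] that by (simp add: root_value_def simple_def index_set_def)
  have mono: "y b \<le> y a" if "1 \<le> a" "a \<le> b" "b \<le> n + 1" for a b
    using that(2,3)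
  proof (induction b rule: dec_induct)
    case (step m)
    then show ?case using \<open>1 \<le> a\<close> descend[of m] by simp
  qed simp
  have last: "y n + y (n + 1) \<ge> 0"
    using nonneg[of "n + 1"] by (simp add: root_value_def simple_def index_set_def)
  have "root_value y r \<ge> 0" if "r \<in> pos_roots" for r
  proof -
    obtain a b s where r: "r = (a, b, s)" by (cases r)
    have ab: "1 \<le> a" "a < b" "b \<le> n + 1" using that r by (auto simp: pos_roots_def)
    show ?thesis
      using mono[of a b] mono[of a n] mono[of b "n + 1"] last ab n3
      by (auto simp: r root_value_def)
  qed
  then show False using assms by (force simp: negative_roots_def)
qed

text \<open>The sign changes come in pairs, since only the reflection in \<open>e\<^sub>n + e\<^sub>n\<^sub>+\<^sub>1\<close> changes signs.\<close>

lemma act_signed_permutation: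
  assumes "set w \<subseteq> index_set n"
  obtains \<pi> \<epsilon> where "\<pi> permutes index_set n"
    "\<And>a. \<epsilon> a = 1 \<or> \<epsilon> a = (- 1 :: real)" "prod \<epsilon> (index_set n) = 1"
    "\<And>y a. a \<in> index_set n \<Longrightarrow> act w y a = \<epsilon> a * y (\<pi> a)"
    "\<And>y a. a \<notin> index_set n \<Longrightarrow> act w y a = y a"
proof -
  have "\<exists>\<pi> \<epsilon>. \<pi> permutes index_set n \<and> (\<forall>a. \<epsilon> a = 1 \<or> \<epsilon> a = (- 1 :: real)) \<and>
      prod \<epsilon> (index_set n) = 1 \<and> (\<forall>y. \<forall>a\<in>index_set n. act w y a = \<epsilon> a * y (\<pi> a)) \<and>
      (\<forall>y a. a \<notin> index_set n \<longrightarrow> act w y a = y a)"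
    using assms
  proof (induction w)
    case Nil
    then show ?case by (intro exI[of _ id] exI[of _ "\<lambda>_. 1"]) (auto simp: permutes_id[unfolded id_def])
  next
    case (Cons i w)
    then have "set w \<subseteq> index_set n" by simp
    from Cons.IH[OF this] obtain \<pi> \<epsilon> where
      p: "\<pi> permutes index_set n" and e: "\<And>a. \<epsilon> a = 1 \<or> \<epsilon> a = (- 1 :: real)"
      and prod: "prod \<epsilon> (index_set n) = 1"
      and act: "\<And>y a. a \<in> index_set n \<Longrightarrow> act w y a = \<epsilon> a * y (\<pi> a)"
      and out: "\<And>y a. a \<notin> index_set n \<Longrightarrow> act w y a = y a"
      by blast
    have i: "i \<in> index_set n" using Cons.prems by simp
    \<comment> \<open>The \<open>i\<close>-th reflection transposes coordinates \<open>j\<close>, \<open>j + 1\<close> and multiplies with the signs \<open>\<delta>\<close>.\<close>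
    define j where "j = (if i = n + 1 then n else i)"
    define \<delta> :: "nat \<Rightarrow> real" where "\<delta> a = (if i = n + 1 \<and> (a = n \<or> a = n + 1) then - 1 else 1)" for a
    define \<tau> where "\<tau> = transpose j (j + 1)"
    have j: "j \<in> index_set n" "j + 1 \<in> index_set n"
      using i n3 by (auto simp: j_def index_set_def)
    have \<tau>: "\<tau> permutes index_set n" unfolding \<tau>_def using j by (rule permutes_swap_id)
    have swap: "signed_swap i y a = \<delta> a * y (\<tau> a)" for y a
      unfolding signed_swap_def \<delta>_def \<tau>_def j_def transpose_def by auto
    have "prod \<delta> (index_set n) = (\<Prod>a\<in>(if i = n + 1 then {n, n + 1} else {}). - 1)"
      using n3 by (intro prod.mono_neutral_cong_right) (auto simp: \<delta>_def index_set_def split: if_splits)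
    then have "prod \<delta> (index_set n) = 1" by auto
    moreover have "prod (\<lambda>a. \<epsilon> (\<tau> a)) (index_set n) = 1"
      using prod.permute[OF \<tau>, of \<epsilon>] prod by (simp add: o_def)
    ultimately have "prod (\<lambda>a. \<delta> a * \<epsilon> (\<tau> a)) (index_set n) = 1" by (simp add: prod.distrib)
    moreover have "\<pi> \<circ> \<tau> permutes index_set n" using \<tau> p by (rule permutes_compose)
    moreover have "\<delta> a * \<epsilon> (\<tau> a) = 1 \<or> \<delta> a * \<epsilon> (\<tau> a) = - 1" for a
      using e[of "\<tau> a"] by (auto simp: \<delta>_def)
    moreover have "act (i # w) y a = (\<delta> a * \<epsilon> (\<tau> a)) * y ((\<pi> \<circ> \<tau>) a)" if "a \<in> index_set n" for y a
      using act[of "\<tau> a"] that permutes_in_image[OF \<tau>] by (simp add: swap)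
    moreover have "act (i # w) y a = y a" if "a \<notin> index_set n" for y a
    proof -
      have "\<tau> a = a" using \<tau> that by (rule permutes_not_in)
      moreover have "\<delta> a = 1" using that n3 by (auto simp: \<delta>_def index_set_def)
      ultimately show ?thesis using out that by (simp add: swap)
    qed
    ultimately show ?case
      by (intro exI[of _ "\<pi> \<circ> \<tau>"] exI[of _ "\<lambda>a. \<delta> a * \<epsilon> (\<tau> a)"]) blast
  qed
  then show ?thesis using that by blast
qed

text \<open>A vector in the interior of the dominant chamber: all positive roots are positive on it.\<close>

definition dominant :: "nat \<Rightarrow> real" where
  "dominant a = (if a \<in> index_set n then real (n + 2) - real a else 0)"

lemma dominant_in_range: "\<exists>v. euclid v = dominant"
proof
  \<comment> \<open>\<open>f a\<close> is the sum of the first \<open>a\<close> Euclidean coordinates \<open>n + 1, n, \<dots>\<close>\<close>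
  define f where "f a = real a * (real n + 2) - real a * (real a + 1) / 2" for a :: nat
  define v where "v a = (if a \<in> index_set n then if a < n then f a
      else if a = n then (f (n - 1) + 1) / 2 else (f (n - 1) + 3) / 2 else 0)" for a
  have f: "f a - f (a - 1) = real n + 2 - real a" if "1 \<le> a" for a
    using that by (cases a) (auto simp: f_def field_simps)
  show "euclid v = dominant"
  proof
    fix a
    consider "a = 1" | "1 < a" "a < n" | "a = n" | "a = n + 1" | "a \<notin> index_set n"
      by (force simp: index_set_def)
    then show "euclid v a = dominant a"
    proof cases
      case 1
      then show ?thesis using n3 f[of 1] by (simp add: euclid_def v_def dominant_def index_set_def f_def)
    next
      case 2
      then show ?thesis using n3 f[of a] by (auto simp: euclid_def v_def dominant_def index_set_def)
    next
      case 3
      then show ?thesis using n3 by (auto simp: euclid_def v_def dominant_def index_set_def field_simps)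
    next
      case 4
      then show ?thesis using n3 by (auto simp: euclid_def v_def dominant_def index_set_def field_simps)
    next
      case 5
      then show ?thesis using n3 by (auto simp: euclid_def v_def dominant_def index_set_def)
    qed
  qed
qed

lemma root_value_dominant: "r \<in> pos_roots \<Longrightarrow> root_value dominant r > 0"
  by (cases r) (auto simp: pos_roots_def root_value_def dominant_def index_set_def)

lemma negative_roots_dominant: "negative_roots dominant = {}"
  using root_value_dominant by (force simp: negative_roots_def)

text \<open>If no positive root is negative on the image \<open>z\<close> of the dominant vector, then \<open>z\<^sub>1 \<ge> \<dots> \<ge> z\<^sub>n \<ge> \<bar>z\<^sub>n\<^sub>+\<^sub>1\<bar>\<close>.
  So all signs but the last one are positive, and the last one is because the number of sign changes
  is even. Then the permutation preserves the order and is the identity.\<close>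

lemma act_id_if_no_negative_roots:
  assumes w: "set w \<subseteq> index_set n" and none: "negative_roots (act w dominant) = {}"
  shows "act w y = y"
proof -
  obtain \<pi> \<epsilon> where p: "\<pi> permutes index_set n"
    and e: "\<And>a. \<epsilon> a = 1 \<or> \<epsilon> a = (- 1 :: real)" and prod: "prod \<epsilon> (index_set n) = 1"
    and act: "\<And>y a. a \<in> index_set n \<Longrightarrow> act w y a = \<epsilon> a * y (\<pi> a)"
    and out: "\<And>y a. a \<notin> index_set n \<Longrightarrow> act w y a = y a"
    using act_signed_permutation[OF w] by blast
  define z where "z = act w dominant"
  have nonneg: "root_value z r \<ge> 0" if "r \<in> pos_roots" for r
  proof -
    have "\<not> root_value z r < 0" using none that unfolding negative_roots_def z_def by blast
    then show ?thesis by simp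
  qed
  have z: "z a = \<epsilon> a * (real (n + 2) - real (\<pi> a))" if "a \<in> index_set n" for a
    using act[OF that, of dominant] permutes_in_image[OF p, of a] that
    by (simp add: z_def dominant_def)
  have low: "real (n + 2) - real (\<pi> a) > 0" if "a \<in> index_set n" for a
    using permutes_in_image[OF p, of a] that by (simp add: index_set_def)
  have pos: "\<epsilon> a = 1" if a: "1 \<le> a" "a \<le> n" for a
  proof (rule ccontr)
    assume "\<epsilon> a \<noteq> 1"
    then have "\<epsilon> a = - 1" using e[of a] by blast
    moreover have "a \<in> index_set n" using a by (simp add: index_set_def)
    ultimately have "z a < 0" using z low[of a] by simp
    moreover have "z a + z (n + 1) \<ge> 0" "z a - z (n + 1) \<ge> 0"
      using nonneg[of "(a, n + 1, True)"] nonneg[of "(a, n + 1, False)"] a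
      by (simp_all add: pos_roots_def root_value_def)
    ultimately show False by linarith
  qed
  have "index_set n = insert (n + 1) {1..n}" by (auto simp: index_set_def)
  then have "prod \<epsilon> (index_set n) = \<epsilon> (n + 1) * prod \<epsilon> {1..n}" by simp
  moreover have "prod \<epsilon> {1..n} = 1" using pos by (intro prod.neutral) auto
  ultimately have last: "\<epsilon> (n + 1) = 1" using prod by simp
  have eps: "\<epsilon> a = 1" if "a \<in> index_set n" for a
    using pos[of a] last that by (cases "a = n + 1") (auto simp: index_set_def)
  have "\<pi> a \<le> \<pi> b" if ab: "1 \<le> a" "a < b" "b \<le> n + 1" for a b
  proof -
    have "z a - z b \<ge> 0"
      using nonneg[of "(a, b, False)"] ab by (simp add: pos_roots_def root_value_def)
    moreover have "a \<in> index_set n" "b \<in> index_set n" using ab by (auto simp: index_set_def)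
    ultimately show ?thesis using z[of a] z[of b] eps by simp
  qed
  then have "\<pi> a = a" if "a \<in> index_set n" for a
    using monotone_permutation_id[of \<pi> "n + 1" a] p that by (simp add: index_set_def)
  then show ?thesis using act out eps by (intro ext) (metis mult_1)
qed

section \<open>The longest element\<close>

text \<open>As long as some positive root is negative, a simple one is, and multiplying with its reflection
  lowers the number of negative roots by one. When none is left, the element is the identity.\<close>

lemma word_of_length_negative_roots:
  assumes "set w \<subseteq> index_set n"
  shows "\<exists>w'. set w' \<subseteq> index_set n \<and> word_prod n w' = word_prod n w \<and>
    length w' = card (negative_roots (act w dominant))"
  using assms
proof (induction "card (negative_roots (act w dominant))" arbitrary: w)
  case 0
  then have "negative_roots (act w dominant) = {}" using finite_negative_roots by simp
  then have "euclid (word_prod n w v) = euclid v" for v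
    using act_id_if_no_negative_roots[OF 0(2)] euclid_word_prod[OF 0(2)] by simp
  then have "word_prod n w v = v" for v using euclid_inj by blast
  then have "word_prod n w = id" by (simp add: fun_eq_iff)
  then show ?case using 0(1) by (intro exI[of _ "[]"]) simp
next
  case (Suc k)
  then have "negative_roots (act w dominant) \<noteq> {}" by force
  then obtain i where i: "i \<in> index_set n" "root_value (act w dominant) (simple i) < 0"
    using negative_simple_root by blast
  then have k: "k = card (negative_roots (act (i # w) dominant))"
    using card_negative_roots_swap_less[OF i] Suc.hyps(2) by simp
  moreover have iw: "set (i # w) \<subseteq> index_set n" using i Suc.prems by simp
  ultimately obtain w' where w': "set w' \<subseteq> index_set n" "word_prod n w' = word_prod n (i # w)"
    "length w' = k"
    using Suc.hyps(1)[OF k iw] by auto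
  have "word_prod n (i # w') = (simple_reflection n i \<circ> simple_reflection n i) \<circ> word_prod n w"
    using w'(2) by (simp add: o_assoc)
  then have "word_prod n (i # w') = word_prod n w" using reflection_involution[OF i(1)] by simp
  then show ?case using w' i(1) Suc.hyps(2) by (intro exI[of _ "i # w'"]) simp
qed

text \<open>The map induced by \<open>\<or>\<close> in Euclidean coordinates.\<close>

definition flip_last :: "(nat \<Rightarrow> real) \<Rightarrow> nat \<Rightarrow> real" where
  "flip_last y = y(n + 1 := - y (n + 1))"

lemma flip_last_flip_last [simp]: "flip_last (flip_last y) = y"
  by (auto simp: flip_last_def)

lemma signed_swap_vee:
  "i \<in> index_set n \<Longrightarrow> signed_swap (vee n i) (flip_last y) = flip_last (signed_swap i y)"
  by (auto simp: signed_swap_def flip_last_def vee_def index_set_def fun_eq_iff)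

lemma act_vee:
  "set w \<subseteq> index_set n \<Longrightarrow> act (map (vee n) w) (flip_last y) = flip_last (act w y)"
  by (induction w) (simp_all add: signed_swap_vee)

lemma act_upt:
  assumes "1 \<le> i" "i \<le> n + 1"
  shows "act [i..<n + 1] y a =
    (if a = i then y (n + 1) else if i < a \<and> a \<le> n + 1 then y (a - 1) else y a)"
  using assms(2,1)
proof (induction i arbitrary: a rule: inc_induct)
  case (step i)
  then have "[i..<n + 1] = i # [Suc i..<n + 1]" by (intro upt_conv_Cons) simp
  then show ?case using step by (auto simp: signed_swap_def simp del: upt_Suc)
qed auto

lemma blocks_vee: "blocks m (map (vee n) w) = map (vee n) (blocks m w)"
  by (induction m) (auto simp: blocks_Suc funpow_swap1)

text \<open>The twisted Coxeter element of the word \<open>1 \<dots> n\<close> in Euclidean coordinates.\<close>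

definition shift_flip :: "(nat \<Rightarrow> real) \<Rightarrow> nat \<Rightarrow> real" where
  "shift_flip y = act [1..<n + 1] (flip_last y)"

lemma shift_flip_apply:
  "shift_flip y a = (if a = 1 then - y (n + 1) else if 1 < a \<and> a \<le> n + 1 then y (a - 1) else y a)"
  unfolding shift_flip_def using n3 by (subst act_upt) (auto simp: flip_last_def)

lemma act_blocks:
  "act (blocks m [1..<n + 1]) ((flip_last ^^ m) y) = (shift_flip ^^ m) y"
proof (induction m arbitrary: y)
  case (Suc m)
  have I: "set (blocks m [1..<n + 1]) \<subseteq> index_set n"
    by (intro set_blocks) (auto simp: index_set_def)
  have "act (blocks (Suc m) [1..<n + 1]) ((flip_last ^^ Suc m) y) =
      act [1..<n + 1] (flip_last (act (blocks m [1..<n + 1]) ((flip_last ^^ m) y)))"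
    unfolding blocks_Suc_front blocks_vee using act_vee[OF I] by (simp del: upt_Suc)
  then show ?case unfolding Suc shift_flip_def[symmetric] by (simp only: funpow.simps o_apply)
qed simp

lemma shift_flip_funpow:
  "k \<le> n + 1 \<Longrightarrow> (shift_flip ^^ k) y a =
    (if a \<in> index_set n then if a \<le> k then - y (n + 1 + a - k) else y (a - k) else y a)"
proof (induction k arbitrary: a)
  case (Suc k)
  then show ?case by (auto simp: shift_flip_apply index_set_def Suc_diff_le)
qed (auto simp: index_set_def)

lemma flip_last_funpow_involution: "(flip_last ^^ k) ((flip_last ^^ k) y) = y"
  by (induction k arbitrary: y) (simp_all add: funpow_swap1)

text \<open>The longest element, \<open>- \<or>\<^sup>n\<^sup>+\<^sup>1\<close> on the span of the simple roots; coordinates outside the index set stay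
  inert, as under all Weyl group elements.\<close>

definition opposition :: "root_vec \<Rightarrow> root_vec" where
  "opposition v = (\<lambda>a. if a \<in> index_set n then - v ((vee n ^^ (n + 1)) a) else v a)"

abbreviation standard_word :: "nat list" where
  "standard_word \<equiv> blocks (n + 1) [1..<n + 1]"

lemma set_standard_word: "set standard_word \<subseteq> index_set n"
  by (intro set_blocks) (auto simp: index_set_def)

text \<open>One block combined with the twist is the signed cycle \<open>(y\<^sub>1, \<dots>, y\<^sub>n\<^sub>+\<^sub>1) \<mapsto> (- y\<^sub>n\<^sub>+\<^sub>1, y\<^sub>1, \<dots>, y\<^sub>n)\<close>,
  whose power with exponent \<open>n + 1\<close> is \<open>- 1\<close>.\<close>

lemma act_standard_word:
  "act standard_word y =
    (\<lambda>a. if a \<in> index_set n then - (flip_last ^^ (n + 1)) y a else y a)"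
proof
  fix a
  have out: "(flip_last ^^ k) y a = y a" if "a \<notin> index_set n" for k
    using that n3 by (induction k) (auto simp: flip_last_def index_set_def)
  have "act standard_word y = (shift_flip ^^ (n + 1)) ((flip_last ^^ (n + 1)) y)"
    using act_blocks[of "n + 1" "(flip_last ^^ (n + 1)) y"]
    unfolding flip_last_funpow_involution .
  then show "act standard_word y a =
      (if a \<in> index_set n then - (flip_last ^^ (n + 1)) y a else y a)"
    using shift_flip_funpow[of "n + 1" "(flip_last ^^ (n + 1)) y" a] out[of "n + 1"]
    by (auto simp: index_set_def simp del: funpow.simps)
qed

lemma euclid_vee: "euclid (v \<circ> vee n) = flip_last (euclid v)"
  using n3 by (auto simp: euclid_def flip_last_def vee_def fun_eq_iff)

lemma euclid_vee_funpow: "euclid (v \<circ> (vee n ^^ k)) = (flip_last ^^ k) (euclid v)"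
proof (induction k arbitrary: v)
  case (Suc k)
  have "v \<circ> (vee n ^^ Suc k) = (v \<circ> (vee n ^^ k)) \<circ> vee n"
    by (auto simp: funpow_swap1)
  then have "euclid (v \<circ> (vee n ^^ Suc k)) = flip_last ((flip_last ^^ k) (euclid v))"
    by (simp only: euclid_vee Suc)
  moreover have "(flip_last ^^ Suc k) (euclid v) = flip_last ((flip_last ^^ k) (euclid v))"
    by simp
  ultimately show ?case by (rule trans[OF _ sym])
qed simp

lemma word_prod_standard_word: "word_prod n standard_word = opposition"
proof
  fix v
  have neg: "euclid (\<lambda>a. if a \<in> index_set n then - u a else v a) a =
      (if a \<in> index_set n then - euclid u a else euclid v a)" for u a
    using n3 by (auto simp: euclid_def index_set_def)
  have "opposition v = (\<lambda>a. if a \<in> index_set n then - (v \<circ> (vee n ^^ (n + 1))) a else v a)"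
    unfolding opposition_def o_apply ..
  then have "euclid (opposition v) =
      (\<lambda>a. if a \<in> index_set n then - (flip_last ^^ (n + 1)) (euclid v) a else euclid v a)"
    unfolding euclid_vee_funpow[symmetric] using neg by presburger
  then have "euclid (word_prod n standard_word v) = euclid (opposition v)"
    unfolding euclid_word_prod[OF set_standard_word] act_standard_word by simp
  then show "word_prod n standard_word v = opposition v" by (rule euclid_inj)
qed

lemma opposition_opposition: "opposition \<circ> opposition = id"
proof
  fix v
  have "(vee n ^^ (n + 1)) a \<in> index_set n \<longleftrightarrow> a \<in> index_set n" for a
    by (rule vee_funpow_in_index_set)
  moreover have "(vee n ^^ (n + 1)) ((vee n ^^ (n + 1)) a) = a" for a
    by (rule vee_funpow_involution)
  ultimately show "(opposition \<circ> opposition) v = id v"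
    unfolding opposition_def o_def id_def by (intro ext) (simp del: funpow.simps)
qed

lemma root_value_standard_word:
  assumes "r \<in> pos_roots"
  shows "\<exists>r'\<in>pos_roots. root_value (act standard_word y) r = - root_value y r'"
proof -
  obtain a b s where r: "r = (a, b, s)" by (cases r)
  have ab: "a \<in> index_set n" "b \<in> index_set n" "a < b" "a < n + 1"
    using assms r by (auto simp: pos_roots_def index_set_def)
  have "(flip_last ^^ k) y = y \<or> (flip_last ^^ k) y = flip_last y" for k
    by (induction k) auto
  then consider "(flip_last ^^ (n + 1)) y = y" | "(flip_last ^^ (n + 1)) y = flip_last y" by blast
  then show ?thesis
  proof cases
    case 1
    have "root_value (act standard_word y) r = - root_value y r"
      unfolding act_standard_word 1 using ab r by (simp add: root_value_def)
    then show ?thesis using assms by blast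
  next
    case 2
    have "root_value (act standard_word y) r = - root_value y (a, b, if b = n + 1 then \<not> s else s)"
      unfolding act_standard_word 2 using ab r by (simp add: root_value_def flip_last_def)
    moreover have "(a, b, if b = n + 1 then \<not> s else s) \<in> pos_roots"
      using assms r by (auto simp: pos_roots_def)
    ultimately show ?thesis by blast
  qed
qed

lemma weyl_length_le:
  "set w \<subseteq> index_set n \<Longrightarrow> weyl_length n (word_prod n w) \<le> length w"
  unfolding weyl_length_def by (rule Least_le) auto

lemma weyl_length_le_negative_roots:
  assumes "set w \<subseteq> index_set n"
  shows "weyl_length n (word_prod n w) \<le> card (negative_roots (act w dominant))"
  using word_of_length_negative_roots[OF assms] weyl_length_le by metis

lemma card_negative_roots_le: "card (negative_roots y) \<le> n * (n + 1)"
  using card_mono[OF finite_pos_roots, of "negative_roots y"] card_pos_roots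
  by (auto simp: negative_roots_def)

text \<open>Each letter of a word changes the number of negative roots by at most one, and the opposition
  makes all of them negative; so no word for it is shorter than the number of positive roots.\<close>

lemma weyl_length_opposition: "weyl_length n opposition = n * (n + 1)"
proof (rule antisym)
  show "weyl_length n opposition \<le> n * (n + 1)"
    using weyl_length_le_negative_roots[OF set_standard_word] card_negative_roots_le
    by (simp add: word_prod_standard_word del: One_nat_def) (meson le_trans)
  have "standard_word \<in> lists (index_set n)" using set_standard_word by (intro in_listsI) blast
  then have "\<exists>k. \<exists>w\<in>lists (index_set n). length w = k \<and> word_prod n w = opposition"
    using word_prod_standard_word by blast
  then have "\<exists>w\<in>lists (index_set n). length w = weyl_length n opposition \<and> word_prod n w = opposition"
    unfolding weyl_length_def by (rule LeastI_ex)
  then obtain w where w: "set w \<subseteq> index_set n" "length w = weyl_length n opposition"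
    "word_prod n w = opposition" by auto
  obtain v where v: "euclid v = dominant" using dominant_in_range by blast
  have "act w dominant = act standard_word dominant"
    using euclid_word_prod[OF w(1), of v] euclid_word_prod[OF set_standard_word, of v]
    unfolding w(3) word_prod_standard_word v by simp
  moreover have "negative_roots (act standard_word dominant) = pos_roots"
    using root_value_standard_word[of _ dominant] root_value_dominant
    by (fastforce simp: negative_roots_def)
  ultimately have "n * (n + 1) \<le> length w + card (negative_roots dominant)"
    using card_negative_roots_act[OF w(1), of dominant] card_pos_roots by simp
  then show "n * (n + 1) \<le> weyl_length n opposition"
    using w(2) by (simp add: negative_roots_dominant)
qed

text \<open>An element of maximal length makes all positive roots negative; multiplied with the opposition
  it makes none negative, so the product is the identity.\<close>

lemma maximal_length_unique:
  assumes w: "set w \<subseteq> index_set n" and len: "n * (n + 1) \<le> weyl_length n (word_prod n w)"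
  shows "word_prod n w = opposition"
proof -
  have "card pos_roots \<le> card (negative_roots (act w dominant))"
    using weyl_length_le_negative_roots[OF w] len card_pos_roots by simp
  then have "negative_roots (act w dominant) = pos_roots"
    using finite_pos_roots by (intro card_seteq) (auto simp: negative_roots_def)
  then have neg: "root_value (act w dominant) r < 0" if "r \<in> pos_roots" for r
    using that by (auto simp: negative_roots_def)
  have "negative_roots (act (standard_word @ w) dominant) = {}"
    using root_value_standard_word[of _ "act w dominant"] neg
    by (fastforce simp: negative_roots_def)
  moreover have sw: "set (standard_word @ w) \<subseteq> index_set n" using set_standard_word w by auto
  ultimately have "euclid (word_prod n (standard_word @ w) v) = euclid v" for v
    using act_id_if_no_negative_roots[OF sw] euclid_word_prod[OF sw] by simp
  then have "word_prod n (standard_word @ w) v = v" for v using euclid_inj by blast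
  then have "(opposition \<circ> word_prod n w) v = id v" for v
    unfolding word_prod_append word_prod_standard_word by simp
  then have "opposition \<circ> word_prod n w = id" by (rule ext)
  then have "opposition \<circ> (opposition \<circ> word_prod n w) = opposition" by simp
  then show ?thesis by (simp add: o_assoc opposition_opposition)
qed

theorem longest_element_opposition: "longest_element n = opposition"
  unfolding longest_element_def
proof (rule the_equality)
  have W: "g \<in> weyl_group n \<longleftrightarrow> (\<exists>w. set w \<subseteq> index_set n \<and> g = word_prod n w)" for g
    by (auto simp: weyl_group_def)
  have opp: "opposition \<in> weyl_group n"
    using W set_standard_word word_prod_standard_word by metis
  have "weyl_length n h \<le> n * (n + 1)" if "h \<in> weyl_group n" for h
    using that weyl_length_le_negative_roots card_negative_roots_le unfolding W
    by (metis le_trans)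
  then show "opposition \<in> weyl_group n \<and>
      (\<forall>h\<in>weyl_group n. weyl_length n h \<le> weyl_length n opposition)"
    using opp weyl_length_opposition by simp
  fix g assume g: "g \<in> weyl_group n \<and> (\<forall>h\<in>weyl_group n. weyl_length n h \<le> weyl_length n g)"
  then obtain w where "set w \<subseteq> index_set n" "g = word_prod n w" using W by blast
  moreover have "n * (n + 1) \<le> weyl_length n g" using g opp weyl_length_opposition by metis
  ultimately show "g = opposition" using maximal_length_unique by blast
qed

lemma star_eq:
  assumes "i \<in> index_set n"
  shows "star n i = (vee n ^^ (n + 1)) i"
  unfolding star_def longest_element_opposition
proof (rule the_equality)
  have eq: "opposition (simple_root i) = (\<lambda>k. - simple_root ((vee n ^^ (n + 1)) i) k)"
  proof
    fix k
    have "(vee n ^^ (n + 1)) k = i \<longleftrightarrow> k = (vee n ^^ (n + 1)) i"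
      using vee_funpow_involution by metis
    moreover have "(vee n ^^ (n + 1)) i \<in> index_set n"
      using assms by (simp only: vee_funpow_in_index_set)
    ultimately show "opposition (simple_root i) k = - simple_root ((vee n ^^ (n + 1)) i) k"
      using assms by (auto simp: opposition_def simple_root_def simp del: funpow.simps)
  qed
  then show "(vee n ^^ (n + 1)) i \<in> index_set n \<and>
      opposition (simple_root i) = (\<lambda>k. - simple_root ((vee n ^^ (n + 1)) i) k)"
    using assms by (simp only: vee_funpow_in_index_set)
  fix j assume "j \<in> index_set n \<and> opposition (simple_root i) = (\<lambda>k. - simple_root j k)"
  then have "- simple_root j j = - simple_root ((vee n ^^ (n + 1)) i) j"
    using eq by metis
  then show "j = (vee n ^^ (n + 1)) i" by (simp add: simple_root_def split: if_splits)
qed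

lemma reduced_words_longest:
  "w \<in> reduced_words n (longest_element n) \<longleftrightarrow>
    set w \<subseteq> index_set n \<and> word_prod n w = opposition \<and> length w = n * (n + 1)"
  unfolding reduced_words_def longest_element_opposition weyl_length_opposition by auto

lemma reflection_vee:
  assumes "i \<in> index_set n"
  shows "simple_reflection n (vee n i) (v \<circ> vee n) = simple_reflection n i v \<circ> vee n"
proof (rule euclid_inj)
  show "euclid (simple_reflection n (vee n i) (v \<circ> vee n)) = euclid (simple_reflection n i v \<circ> vee n)"
    using assms by (simp add: euclid_reflection euclid_vee signed_swap_vee)
qed

lemma opposition_reflection:
  assumes i: "i \<in> index_set n"
  shows "opposition \<circ> simple_reflection n i = simple_reflection n ((vee n ^^ (n + 1)) i) \<circ> opposition"
proof
  fix v
  have vk: "simple_reflection n i u \<circ> (vee n ^^ k) = simple_reflection n ((vee n ^^ k) i) (u \<circ> (vee n ^^ k))" for u k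
  proof (induction k)
    case (Suc k)
    have "w \<circ> (vee n ^^ Suc k) = (w \<circ> (vee n ^^ k)) \<circ> vee n" for w :: root_vec
      by (auto simp: funpow_swap1)
    moreover have "(vee n ^^ k) i \<in> index_set n" using i by simp
    ultimately have "simple_reflection n i u \<circ> (vee n ^^ Suc k) =
        simple_reflection n (vee n ((vee n ^^ k) i)) (u \<circ> (vee n ^^ Suc k))"
      using reflection_vee by (simp only: Suc)
    moreover have "(vee n ^^ Suc k) i = vee n ((vee n ^^ k) i)" by simp
    ultimately show ?case by (rule ssubst[where P = "\<lambda>j. _ = simple_reflection n j _", rotated])
  qed simp
  have opp: "opposition u = (\<lambda>a. if a \<in> index_set n then - (u \<circ> (vee n ^^ (n + 1))) a else u a)" for u
    unfolding opposition_def o_apply ..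
  define j where "j = (vee n ^^ (n + 1)) i"
  have j: "j \<in> index_set n" unfolding j_def using i by (simp only: vee_funpow_in_index_set)
  have sub: "(\<Sum>k | k \<in> index_set n \<and> edge n j k. (if k \<in> index_set n then - u k else w k)) =
      - (\<Sum>k | k \<in> index_set n \<and> edge n j k. u k)" for u w :: root_vec
    by (subst sum_negf[symmetric], rule sum.cong) auto
  have "opposition (simple_reflection n i v) =
      (\<lambda>a. if a \<in> index_set n then - simple_reflection n j (v \<circ> (vee n ^^ (n + 1))) a else v a)"
    unfolding opp vk j_def[symmetric] using i by (auto simp: simple_reflection_def fun_eq_iff)
  also have "\<dots> = simple_reflection n j (opposition v)"
    unfolding opp simple_reflection_neighbours[OF j] sub using j by (auto simp: fun_eq_iff)
  finally show "(opposition \<circ> simple_reflection n i) v =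
      (simple_reflection n ((vee n ^^ (n + 1)) i) \<circ> opposition) v"
    by (simp add: j_def)
qed

section \<open>Twisted Coxeter elements\<close>

lemma reflection_other: "j \<noteq> i \<Longrightarrow> simple_reflection n i v j = v j"
  by (simp add: simple_reflection_def)

lemma word_prod_fixes: "j \<notin> set w \<Longrightarrow> word_prod n w v j = v j"
  by (induction w) (simp_all add: reflection_other)

text \<open>The \<open>i\<close>-th coordinate changes only when \<open>s\<^sub>i\<close> is applied, and at this moment precisely the letters of \<open>b\<close>
  have been applied.\<close>

lemma coxeter_coordinate:
  assumes "distinct (a @ i # b)" "i \<in> index_set n"
  shows "word_prod n (a @ i # b) v i + v i =
    (\<Sum>j | j \<in> index_set n \<and> edge n i j. if j \<in> set b then word_prod n (a @ i # b) v j else v j)"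
proof -
  have "word_prod n (a @ i # b) v i = simple_reflection n i (word_prod n b v) i"
    using assms by (simp add: word_prod_append word_prod_fixes)
  also have "\<dots> = (\<Sum>j | j \<in> index_set n \<and> edge n i j. word_prod n b v j) - v i"
    using assms by (simp add: simple_reflection_neighbours word_prod_fixes)
  also have "(\<Sum>j | j \<in> index_set n \<and> edge n i j. word_prod n b v j) =
      (\<Sum>j | j \<in> index_set n \<and> edge n i j. if j \<in> set b then word_prod n (a @ i # b) v j else v j)"
  proof (rule sum.cong[OF refl])
    fix j assume j: "j \<in> {j. j \<in> index_set n \<and> edge n i j}"
    show "word_prod n b v j = (if j \<in> set b then word_prod n (a @ i # b) v j else v j)"
    proof (cases "j \<in> set b")
      case True
      then have "j \<notin> set a" "j \<noteq> i" using assms(1) by auto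
      then show ?thesis using True by (simp add: word_prod_append word_prod_fixes reflection_other)
    qed (simp add: word_prod_fixes)
  qed
  finally show ?thesis by simp
qed

lemma word_prod_rev: "set w \<subseteq> index_set n \<Longrightarrow> word_prod n w (word_prod n (rev w) v) = v"
proof (induction w arbitrary: v)
  case (Cons i w)
  have "simple_reflection n i (simple_reflection n i u) = u" for u
    using reflection_involution[of i] Cons.prems by (metis comp_apply id_apply insert_subset list.set(2))
  then show ?case using Cons by (simp add: word_prod_append)
qed simp

lemma coxeter_moves:
  assumes "distinct w" "set w \<subseteq> index_set n" "i \<in> set w"
  shows "\<exists>v. word_prod n w v i \<noteq> v i"
proof -
  obtain a b where w: "w = a @ i # b" using assms(3) split_list by metis
  define v where "v = word_prod n (rev b) (simple_root i)"
  have i: "i \<in> index_set n" and b: "set b \<subseteq> index_set n" using assms w by auto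
  have irr: "\<not> edge n i i" unfolding edge_iff using n3 by auto
  have "word_prod n w v i = simple_reflection n i (simple_root i) i"
    using assms(1) w word_prod_rev[OF b] by (simp add: v_def word_prod_append word_prod_fixes)
  also have "\<dots> = - 1"
    unfolding simple_reflection_neighbours[OF i] using irr
    by (simp add: simple_root_def) (intro sum.neutral, auto)
  finally have "word_prod n w v i = - 1" .
  moreover have "v i = 1"
    using assms(1) w by (simp add: v_def word_prod_fixes simple_root_def)
  ultimately have "word_prod n w v i \<noteq> v i" by simp
  then show ?thesis by blast
qed

text \<open>Suppose that two words have the same product \<open>c\<close> and let \<open>k\<close> be the smallest letter whose order
  relative to \<open>k + 1\<close> differs. In the formula for the \<open>k\<close>-th coordinate of \<open>c v\<close> the contributions of all
  neighbours of \<open>k\<close> other than \<open>k + 1\<close> agree. So \<open>c\<close> would fix the coordinate \<open>k + 1\<close>, but every letter of a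
  word with distinct letters moves its own coordinate.\<close>

lemma ascents_from_word_prod:
  assumes p: "perm_word p" and q: "perm_word q" and eq: "word_prod n p = word_prod n q"
  shows "ascents p = ascents q"
proof (rule ccontr)
  assume "ascents p \<noteq> ascents q"
  then have ex: "\<exists>k. (k \<in> ascents p) \<noteq> (k \<in> ascents q)" by blast
  define k where "k = (LEAST k. (k \<in> ascents p) \<noteq> (k \<in> ascents q))"
  have k: "(k \<in> ascents p) \<noteq> (k \<in> ascents q)" unfolding k_def using ex by (rule LeastI_ex)
  have least: "j \<in> ascents p \<longleftrightarrow> j \<in> ascents q" if "j < k" for j
    using not_less_Least[of j "\<lambda>k. (k \<in> ascents p) \<noteq> (k \<in> ascents q)"] that unfolding k_def by blast
  have kn: "1 \<le> k" "k < n" using k by (auto simp: ascents_def)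
  have kI: "k \<in> index_set n" "k + 1 \<in> index_set n" using kn by (auto simp: index_set_def)
  have dp: "distinct p" "set p = {1..n}" and dq: "distinct q" "set q = {1..n}"
    using p q by (auto simp: perm_word_def)
  obtain a b where ab: "p = a @ k # b" using dp kn split_list[of k p] by auto
  obtain c d where cd: "q = c @ k # d" using dq kn split_list[of k q] by auto
  have up: "k + 1 \<in> set b \<longleftrightarrow> k \<in> ascents p" "k + 1 \<in> set d \<longleftrightarrow> k \<in> ascents q"
    using filter_pair_split(1)[OF dp(1) ab, of "k + 1"] filter_pair_split(1)[OF dq(1) cd, of "k + 1"]
      kn dp(2) dq(2) by (simp_all add: ascents_def)
  have others: "j \<in> set b \<longleftrightarrow> j \<in> set d" if j: "edge n k j" "j \<noteq> k + 1" for j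
  proof -
    consider "j = k - 1" "2 \<le> k" | "j = n + 1"
      using j kn unfolding edge_iff by force
    then show ?thesis
    proof cases
      case 1
      then have j1: "j + 1 = k" "j \<in> {1..<n}" "j < k" using kn by auto
      have "j \<notin> set b \<longleftrightarrow> j \<in> ascents p"
        using filter_pair_split(2)[OF dp(1) ab, of j] j1 dp(2) by (auto simp: ascents_def)
      moreover have "j \<notin> set d \<longleftrightarrow> j \<in> ascents q"
        using filter_pair_split(2)[OF dq(1) cd, of j] j1 dq(2) by (auto simp: ascents_def)
      ultimately show ?thesis using least[OF \<open>j < k\<close>] by blast
    next
      case 2
      have "n + 1 \<notin> set p" "n + 1 \<notin> set q" using dp(2) dq(2) by auto
      then show ?thesis using ab cd 2 by auto
    qed
  qed
  have "word_prod n p v (k + 1) = v (k + 1)" for v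
  proof -
    define u where "u = word_prod n p v"
    define N where "N = {j. j \<in> index_set n \<and> edge n k j}"
    have N: "finite N" "k + 1 \<in> N" using kI kn by (auto simp: N_def index_set_def edge_iff)
    have "(\<Sum>j\<in>N. if j \<in> set b then u j else v j) = u k + v k"
      using coxeter_coordinate[of a k b v, folded ab, OF dp(1) kI(1)] unfolding u_def N_def by simp
    also have "\<dots> = (\<Sum>j\<in>N. if j \<in> set d then u j else v j)"
      using coxeter_coordinate[of c k d v, folded cd, OF dq(1) kI(1)] unfolding u_def N_def eq by simp
    finally have sums: "(\<Sum>j\<in>N. if j \<in> set b then u j else v j) = (\<Sum>j\<in>N. if j \<in> set d then u j else v j)" .
    have "(\<Sum>j\<in>N - {k + 1}. if j \<in> set b then u j else v j) =
        (\<Sum>j\<in>N - {k + 1}. if j \<in> set d then u j else v j)"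
      using others by (intro sum.cong) (auto simp: N_def)
    then have "(if k + 1 \<in> set b then u (k + 1) else v (k + 1)) =
        (if k + 1 \<in> set d then u (k + 1) else v (k + 1))"
      using sums N by (simp add: sum.remove[of N "k + 1"] del: One_nat_def add_Suc_right)
    then show ?thesis using up k unfolding u_def by (auto split: if_splits)
  qed
  moreover have "set p \<subseteq> index_set n" "k + 1 \<in> set p"
    using dp(2) kn by (auto simp: index_set_def)
  ultimately show False using coxeter_moves[OF dp(1)] by blast
qed

lemma word_prod_vee:
  "set w \<subseteq> index_set n \<Longrightarrow> word_prod n (map (vee n) w) (v \<circ> vee n) = word_prod n w v \<circ> vee n"
  by (induction w) (simp_all add: reflection_vee)

lemma comp_vee_vee: "(v \<circ> vee n) \<circ> vee n = v"
  by (simp add: fun_eq_iff)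

lemma equiv_if_word_prod_eq:
  assumes w: "twisted_word w" and w': "twisted_word w'" and eq: "word_prod n w = word_prod n w'"
  shows "w \<approx> w'"
proof -
  have d: "distinct w" "set w \<subseteq> index_set n" "distinct w'" "set w' \<subseteq> index_set n"
    using w w' by (auto simp: twisted_word_def perm_word_def fold_word_def distinct_map)
  define b where "b = (n \<in> set w)"
  have moves: "n \<in> set u \<longleftrightarrow> (\<exists>v. word_prod n u v n \<noteq> v n)"
    if "distinct u" "set u \<subseteq> index_set n" for u
    using coxeter_moves[OF that, of n] word_prod_fixes[of n u] by blast
  have b: "b = (n \<in> set w')"
    unfolding b_def moves[OF d(1,2)] moves[OF d(3,4)] eq ..
  define p where "p = fold_word w"
  define q where "q = fold_word w'"
  have pq: "perm_word p" "perm_word q" using w w' by (auto simp: p_def q_def twisted_word_def)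
  have W: "w = unfold_word b p" "w' = unfold_word b q"
    unfolding p_def q_def using unfold_fold_word[OF w] unfold_fold_word[OF w'] b b_def by simp_all
  have I: "set p \<subseteq> index_set n" "set q \<subseteq> index_set n"
    using pq unfolding perm_word_def index_set_def by simp_all
  have "word_prod n p = word_prod n q"
  proof (cases b)
    case True
    then show ?thesis using eq W by (simp add: unfold_word_def)
  next
    case False
    have "word_prod n (map (vee n) p) = word_prod n (map (vee n) q)"
      using eq W False by (simp add: unfold_word_def)
    then have "word_prod n p v \<circ> vee n = word_prod n q v \<circ> vee n" for v
      unfolding word_prod_vee[OF I(1), symmetric] word_prod_vee[OF I(2), symmetric] by simp
    then have "(word_prod n p v \<circ> vee n) \<circ> vee n = (word_prod n q v \<circ> vee n) \<circ> vee n" for v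
      by simp
    then show ?thesis unfolding comp_vee_vee by (rule ext)
  qed
  then have "p \<approx> q" using ascents_from_word_prod equiv_if_ascents_eq pq by blast
  then show ?thesis unfolding W by (rule equiv_unfold)
qed

section \<open>Commutation classes\<close>

lemma reflections_commute_iff:
  assumes "i \<noteq> j"
  shows "simple_reflection n i \<circ> simple_reflection n j = simple_reflection n j \<circ> simple_reflection n i
    \<longleftrightarrow> \<not> edge n i j"
proof
  assume comm: "simple_reflection n i \<circ> simple_reflection n j =
    simple_reflection n j \<circ> simple_reflection n i"
  show "\<not> edge n i j"
  proof
    assume e: "edge n i j"
    then have I: "i \<in> index_set n" "j \<in> index_set n"
      using n3 unfolding edge_iff index_set_def by auto
    have e': "edge n j i" using e edge_sym by blast
    have irr: "\<not> edge n l l" for l unfolding edge_iff using n3 by auto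
    have fin: "finite {k. k \<in> index_set n \<and> edge n l k}" for l by (simp add: index_set_def)
    \<comment> \<open>The two orders give \<open>\<alpha>\<^sub>j\<close> and \<open>- \<alpha>\<^sub>i - \<alpha>\<^sub>j\<close> on \<open>\<alpha>\<^sub>i\<close>; their coordinates at \<open>i\<close> differ.\<close>
    have sj: "simple_reflection n j (simple_root i) = (simple_root i)(j := 1)"
    proof -
      have "(\<Sum>k | k \<in> index_set n \<and> edge n j k. simple_root i k) = 1"
        unfolding simple_root_def using fin[of j] I e' by simp
      then show ?thesis
        using assms unfolding simple_reflection_neighbours[OF I(2)] by (simp add: simple_root_def)
    qed
    have "(\<Sum>k | k \<in> index_set n \<and> edge n i k. ((simple_root i)(j := 1)) k) =
        (\<Sum>k | k \<in> index_set n \<and> edge n i k. if k = j then 1 else 0)"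
      using irr by (intro sum.cong) (auto simp: simple_root_def)
    then have "simple_reflection n i (simple_reflection n j (simple_root i)) i = 0"
      unfolding sj simple_reflection_neighbours[OF I(1)] using fin e I assms
      by (simp add: simple_root_def)
    moreover have "(\<Sum>k | k \<in> index_set n \<and> edge n i k. simple_root i k) = 0"
      using irr by (intro sum.neutral) (auto simp: simple_root_def)
    then have "simple_reflection n j (simple_reflection n i (simple_root i)) i = - 1"
      using assms unfolding reflection_other[OF assms]
      unfolding simple_reflection_neighbours[OF I(1)] by (simp add: simple_root_def)
    ultimately show False using fun_cong[OF comm, of "simple_root i"] by simp
  qed
next
  have sum: "(\<Sum>k\<in>index_set n. cartan n l k * simple_reflection n m v k) =
      (\<Sum>k\<in>index_set n. cartan n l k * v k)" if "\<not> edge n l m" "l \<noteq> m" for l m v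
  proof (rule sum.cong[OF refl])
    fix k
    show "cartan n l k * simple_reflection n m v k = cartan n l k * v k"
      using that by (cases "k = m") (auto simp: cartan_def reflection_other)
  qed
  assume "\<not> edge n i j"
  moreover from this have "\<not> edge n j i" using edge_sym by blast
  ultimately have "simple_reflection n i (simple_reflection n j v) =
      simple_reflection n j (simple_reflection n i v)" for v
    unfolding simple_reflection_def[of n i "simple_reflection n j v"]
      simple_reflection_def[of n j "simple_reflection n i v"]
    using assms sum[of i j v] sum[of j i v]
    by (simp add: reflection_other) (simp add: simple_reflection_def fun_upd_twist)
  then show "simple_reflection n i \<circ> simple_reflection n j =
      simple_reflection n j \<circ> simple_reflection n i" by auto
qed

lemma comm_step_swap: "comm_step n = swap_step dep"
proof -
  have "i \<noteq> j \<and> simple_reflection n i \<circ> simple_reflection n j =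
      simple_reflection n j \<circ> simple_reflection n i \<longleftrightarrow> \<not> dep i j" for i j
    using reflections_commute_iff[of i j] by (auto simp: dep_def)
  then show ?thesis unfolding comm_step_def swap_step_def by (simp only:)
qed

lemma comm_class_equiv: "comm_class n w = {w'. w \<approx> w'}"
  using swap_steps_iff_same_projections[OF dep_refl dep_sym, of w]
  by (auto simp: comm_class_def comm_step_swap)

lemma comm_class_eq_iff: "comm_class n u = comm_class n v \<longleftrightarrow> u \<approx> v"
proof
  assume "comm_class n u = comm_class n v"
  moreover have "v \<in> comm_class n v" unfolding comm_class_equiv by simp
  ultimately have "v \<in> comm_class n u" by simp
  then show "u \<approx> v" unfolding comm_class_equiv by simp
next
  assume uv: "u \<approx> v"
  show "comm_class n u = comm_class n v"
    unfolding comm_class_equiv using equiv_trans[OF uv] equiv_trans[OF equiv_sym[OF uv]] by blast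
qed

lemma word_prod_equiv:
  assumes "u \<approx> v"
  shows "word_prod n u = word_prod n v \<and> length u = length v"
proof -
  have "(u, v) \<in> (swap_step dep)\<^sup>*"
    using assms swap_steps_iff_same_projections[OF dep_refl dep_sym] by blast
  then show ?thesis
  proof (induction rule: rtrancl_induct)
    case (step v w)
    then obtain a b i j where vw: "v = a @ i # j # b" "w = a @ j # i # b" "\<not> dep i j"
      unfolding swap_step_def by auto
    then have "simple_reflection n i \<circ> simple_reflection n j =
        simple_reflection n j \<circ> simple_reflection n i"
      using reflections_commute_iff by (auto simp: dep_def)
    then have "simple_reflection n i \<circ> (simple_reflection n j \<circ> word_prod n b) =
        simple_reflection n j \<circ> (simple_reflection n i \<circ> word_prod n b)"
      by (simp add: o_assoc)
    then show ?case using step.IH vw by (simp add: word_prod_append)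
  qed simp
qed

section \<open>The twisted adapted cluster point\<close>

abbreviation power_word :: "nat list \<Rightarrow> nat list" where
  "power_word \<equiv> blocks (n + 1)"

definition power_class :: "nat list \<Rightarrow> nat list set" where
  "power_class w = comm_class n (power_word w)"

lemma power_class_eq_iff: "power_class w = power_class w' \<longleftrightarrow> power_word w \<approx> power_word w'"
  by (simp add: power_class_def comm_class_eq_iff del: One_nat_def)

lemma power_class_in_cluster:
  assumes "twisted_word w"
  shows "power_class w \<in> twisted_adapted_cluster_point n"
proof -
  define reached where "reached w \<longleftrightarrow> power_word w \<in> reduced_words n (longest_element n) \<and>
    power_class w \<in> twisted_adapted_cluster_point n" for w
  have longest: "power_class w \<in> longest_comm_classes n"
    if "power_word w \<in> reduced_words n (longest_element n)" for w
    using that by (simp add: longest_comm_classes_def power_class_def)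
  have cluster: "power_class w \<in> twisted_adapted_cluster_point n \<longleftrightarrow>
      (power_class [1..<n + 1], power_class w) \<in> reflection_equiv n" for w
    unfolding twisted_adapted_cluster_point_def twisted_power_word_blocks power_class_def by blast
  have "reached w"
  proof (rule rotations_connect)
    show "twisted_word w" by fact
    have "power_word [1..<n + 1] \<in> reduced_words n (longest_element n)"
      unfolding reduced_words_longest
      using set_standard_word word_prod_standard_word length_blocks[of "n + 1" "[1..<n + 1]"]
      by (simp add: mult.commute del: upt_Suc)
    then show "reached [1..<n + 1]"
      unfolding reached_def cluster using longest by (simp add: reflection_equiv_def)
  next
    fix i w assume tw: "twisted_word (i # w)" and r: "reached (i # w)"
    define j where "j = (vee n ^^ (n + 1)) i"
    have i: "i \<in> index_set n" using tw by (simp add: twisted_word_def)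
    have j: "j \<in> index_set n" unfolding j_def using i by (simp only: vee_funpow_in_index_set)
    obtain u where u: "power_word (i # w) = i # u"
      using blocks_Suc_front[of n "i # w"] by simp
    have u': "power_word (w @ [vee n i]) = u @ [j]"
      using blocks_rotate[of "n + 1" i w] unfolding u j_def by simp
    \<comment> \<open>If \<open>s\<^sub>i u = w\<^sub>0\<close>, then \<open>u s\<^sub>j = s\<^sub>i w\<^sub>0 s\<^sub>j = s\<^sub>i s\<^sub>i w\<^sub>0 = w\<^sub>0\<close> with \<open>j = i\<^sup>*\<close>.\<close>
    have red: "i # u \<in> reduced_words n (longest_element n)"
      using r u unfolding reached_def by simp
    then have iu: "simple_reflection n i \<circ> word_prod n u = opposition" "set u \<subseteq> index_set n"
      "length u + 1 = n * (n + 1)"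
      unfolding reduced_words_longest by auto
    have "word_prod n (u @ [j]) = word_prod n u \<circ> simple_reflection n j"
      by (simp add: word_prod_append)
    also have "word_prod n u = simple_reflection n i \<circ> opposition"
      unfolding iu(1)[symmetric] by (simp add: o_assoc reflection_involution[OF i])
    also have "simple_reflection n i \<circ> opposition \<circ> simple_reflection n j =
        simple_reflection n i \<circ> (opposition \<circ> simple_reflection n j)" by (simp add: o_assoc)
    also have "opposition \<circ> simple_reflection n j = simple_reflection n i \<circ> opposition"
      using opposition_reflection[OF j] unfolding j_def vee_funpow_involution .
    also have "simple_reflection n i \<circ> (simple_reflection n i \<circ> opposition) = opposition"
      by (simp add: o_assoc reflection_involution[OF i])
    finally have red': "u @ [j] \<in> reduced_words n (longest_element n)"
      unfolding reduced_words_longest using iu(2,3) j by simp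
    have "star n i = j" using star_eq[OF i] j_def by simp
    then have "(power_class (i # w), power_class (w @ [vee n i])) \<in> reflection_step n"
      unfolding power_class_def u u' reflection_step_def using red by blast
    then show "reached (w @ [vee n i])"
      using r red' longest[of "w @ [vee n i]"] unfolding reached_def cluster u' reflection_equiv_def
      by (auto intro: rtrancl_into_rtrancl)
  next
    fix w w' assume tw: "twisted_word w" "twisted_word w'" and eqv: "w \<approx> w'" and r: "reached w"
    have e: "power_word w \<approx> power_word w'" by (rule equiv_blocks[OF eqv])
    have "power_word w' \<in> reduced_words n (longest_element n)"
      using r word_prod_equiv[OF e] equiv_set[OF e] unfolding reached_def reduced_words_longest
      by (simp del: One_nat_def)
    moreover have "power_class w = power_class w'" using e power_class_eq_iff by blast
    ultimately show "reached w'" using r by (simp add: reached_def)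
  qed
  then show ?thesis by (simp add: reached_def)
qed

lemma reflection_step_power_class:
  assumes w: "twisted_word w" and step: "(power_class w, y) \<in> reflection_step n"
  shows "\<exists>w'. twisted_word w' \<and> y = power_class w'"
proof -
  have I: "i \<in> index_set n" if "u \<in> reduced_words n (longest_element n)" "i \<in> set u" for i u
    using that by (auto simp: reduced_words_longest)
  consider i u where "power_class w = comm_class n (i # u)" "y = comm_class n (u @ [star n i])"
      "i # u \<in> reduced_words n (longest_element n)"
    | i u where "power_class w = comm_class n (u @ [i])" "y = comm_class n (star n i # u)"
      "u @ [i] \<in> reduced_words n (longest_element n)"
    using step unfolding reflection_step_def by blast
  then show ?thesis
  proof cases
    case 1
    have "blocks (Suc n) w \<approx> i # u"
      using 1(1) unfolding power_class_def comm_class_eq_iff by simp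
    from power_word_rotate[OF w equiv_sym[OF this]] obtain w' where
      w': "twisted_word w'" "u @ [(vee n ^^ Suc n) i] \<approx> blocks (Suc n) w'" by blast
    moreover have "star n i = (vee n ^^ Suc n) i"
      using star_eq[of i] I[OF 1(3), of i] by simp
    ultimately have "y = power_class w'"
      unfolding 1(2) power_class_def comm_class_eq_iff by simp
    then show ?thesis using w'(1) by blast
  next
    case 2
    have "blocks (Suc n) w \<approx> u @ [i]"
      using 2(1) unfolding power_class_def comm_class_eq_iff by simp
    from power_word_rotate_back[OF w equiv_sym[OF this]] obtain w' where
      w': "twisted_word w'" "(vee n ^^ Suc n) i # u \<approx> blocks (Suc n) w'" by blast
    moreover have "star n i = (vee n ^^ Suc n) i"
      using star_eq[of i] I[OF 2(3), of i] by simp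
    ultimately have "y = power_class w'"
      unfolding 2(2) power_class_def comm_class_eq_iff by simp
    then show ?thesis using w'(1) by blast
  qed
qed

theorem cluster_eq: "twisted_adapted_cluster_point n = power_class ` {w. twisted_word w}"
proof
  show "power_class ` {w. twisted_word w} \<subseteq> twisted_adapted_cluster_point n"
    using power_class_in_cluster by blast
  have "perm_word [1..<n + 1]" by (auto simp: perm_word_def simp del: upt_Suc)
  then have tw: "twisted_word [1..<n + 1]"
    using twisted_word_unfold[of "[1..<n + 1]" True] by (simp add: unfold_word_def del: upt_Suc)
  show "twisted_adapted_cluster_point n \<subseteq> power_class ` {w. twisted_word w}"
  proof
    fix x assume "x \<in> twisted_adapted_cluster_point n"
    then have "(power_class [1..<n + 1], x) \<in> (reflection_step n)\<^sup>*"
      unfolding twisted_adapted_cluster_point_def reflection_equiv_def twisted_power_word_blocks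
        power_class_def by blast
    then show "x \<in> power_class ` {w. twisted_word w}"
    proof (induction rule: rtrancl_induct)
      case base
      then show ?case using tw by blast
    next
      case (step y z)
      then show ?case using reflection_step_power_class by blast
    qed
  qed
qed

lemma power_class_unfold_eq:
  assumes "perm_word p" "perm_word q" "power_class (unfold_word b p) = power_class (unfold_word c q)"
  shows "b = c \<and> ascents p = ascents q"
  using ascents_from_blocks[OF assms(1,2), of "n - 1"] assms(3) n3 by (simp add: power_class_eq_iff)

lemma power_class_eq_iff_equiv:
  assumes w: "twisted_word w" and w': "twisted_word w'"
  shows "power_class w = power_class w' \<longleftrightarrow> w \<approx> w'"
proof
  assume eq: "power_class w = power_class w'"
  have perm: "perm_word (fold_word w)" "perm_word (fold_word w')"
    using w w' by (auto simp: twisted_word_def)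
  have W: "w = unfold_word (n \<in> set w) (fold_word w)" "w' = unfold_word (n \<in> set w') (fold_word w')"
    using unfold_fold_word w w' by blast+
  have "(n \<in> set w) = (n \<in> set w') \<and> ascents (fold_word w) = ascents (fold_word w')"
    using power_class_unfold_eq[OF perm] eq W by metis
  then have "unfold_word (n \<in> set w) (fold_word w) \<approx> unfold_word (n \<in> set w') (fold_word w')"
    using equiv_unfold[OF equiv_if_ascents_eq[OF perm]] by simp
  then show "w \<approx> w'" unfolding W[symmetric] .
next
  assume "w \<approx> w'"
  then show "power_class w = power_class w'" using equiv_blocks power_class_eq_iff by blast
qed

lemma coxeter_element_eq_iff:
  assumes "twisted_word w" "twisted_word w'"
  shows "word_prod n w \<circ> vee_map n = word_prod n w' \<circ> vee_map n \<longleftrightarrow> w \<approx> w'"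
proof -
  have "vee_map n \<circ> vee_map n = id" by (simp add: vee_map_def fun_eq_iff)
  then have "word_prod n w \<circ> vee_map n = word_prod n w' \<circ> vee_map n \<longleftrightarrow> word_prod n w = word_prod n w'"
    by (metis comp_assoc comp_id)
  then show ?thesis using equiv_if_word_prod_eq[OF assms] word_prod_equiv by blast
qed

theorem card_cluster: "card (twisted_adapted_cluster_point n) = 2 ^ n"
proof -
  define f where "f = (\<lambda>(b, S). power_class (unfold_word b (word_with_ascents S n)))"
  have "bij_betw f (UNIV \<times> Pow {1..<n}) (twisted_adapted_cluster_point n)"
    unfolding bij_betw_def
  proof
    show "inj_on f (UNIV \<times> Pow {1..<n})"
    proof (rule inj_onI, clarify)
      fix b S c T
      assume S: "S \<subseteq> {1..<n}" and T: "T \<subseteq> {1..<n}" and eq: "f (b, S) = f (c, T)"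
      show "b = c \<and> S = T"
        using power_class_unfold_eq[OF perm_word_with_ascents perm_word_with_ascents, of b S c T] eq
          ascents_word_with_ascents[OF S] ascents_word_with_ascents[OF T] by (simp add: f_def)
    qed
    show "f ` (UNIV \<times> Pow {1..<n}) = twisted_adapted_cluster_point n"
    proof
      show "f ` (UNIV \<times> Pow {1..<n}) \<subseteq> twisted_adapted_cluster_point n"
        using twisted_word_unfold[OF perm_word_with_ascents] by (auto simp: cluster_eq f_def)
      show "twisted_adapted_cluster_point n \<subseteq> f ` (UNIV \<times> Pow {1..<n})"
      proof
        fix x assume "x \<in> twisted_adapted_cluster_point n"
        then obtain w where w: "twisted_word w" "x = power_class w" by (auto simp: cluster_eq)
        define p where "p = fold_word w"
        have p: "perm_word p" using w by (simp add: p_def twisted_word_def)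
        have S: "ascents p \<subseteq> {1..<n}" by (auto simp: ascents_def)
        have "p \<approx> word_with_ascents (ascents p) n"
          using equiv_if_ascents_eq[OF p perm_word_with_ascents] ascents_word_with_ascents[OF S] by simp
        then have "w \<approx> unfold_word (n \<in> set w) (word_with_ascents (ascents p) n)"
          using unfold_fold_word[OF w(1)] equiv_unfold unfolding p_def by metis
        then have "x = f (n \<in> set w, ascents p)"
          using w power_class_eq_iff_equiv twisted_word_unfold[OF perm_word_with_ascents]
          by (simp add: f_def)
        then show "x \<in> f ` (UNIV \<times> Pow {1..<n})" using S by blast
      qed
    qed
  qed
  then have "card (twisted_adapted_cluster_point n) = card ((UNIV :: bool set) \<times> Pow {1..<n})"
    by (metis bij_betw_same_card)
  also have "\<dots> = 2 ^ n"
    using n3 by (simp add: card_cartesian_product card_Pow flip: power_Suc)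
  finally show ?thesis .
qed

end

theorem theorem3p10:
  fixes n :: nat
  assumes "n \<ge> 3"
  shows "(\<exists>\<Phi>. bij_betw \<Phi> (twisted_coxeter_elements n) (twisted_adapted_cluster_point n) \<and>
            (\<forall>w\<in>twisted_coxeter_words n.
               \<Phi> (word_prod n w \<circ> vee_map n) = comm_class n (twisted_power_word n w))) \<and>
         card (twisted_adapted_cluster_point n) = 2 ^ n"
proof -
  interpret type_D n using assms by unfold_locales
  define cox where "cox w = word_prod n w \<circ> vee_map n" for w
  define \<Phi> where "\<Phi> x = power_class (SOME w. twisted_word w \<and> cox w = x)" for x
  have key: "cox w = cox w' \<longleftrightarrow> power_class w = power_class w'" if "twisted_word w" "twisted_word w'" for w w'
    using coxeter_element_eq_iff power_class_eq_iff_equiv that unfolding cox_def by blast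
  have \<Phi>: "\<Phi> (cox w) = power_class w" if "twisted_word w" for w
  proof -
    define w' where "w' = (SOME w'. twisted_word w' \<and> cox w' = cox w)"
    have "twisted_word w' \<and> cox w' = cox w"
      unfolding w'_def by (rule someI[of _ w]) (simp add: that)
    then show ?thesis using key that unfolding \<Phi>_def w'_def by blast
  qed
  have elements: "twisted_coxeter_elements n = cox ` {w. twisted_word w}"
    unfolding twisted_coxeter_elements_def cox_def twisted_word_iff by blast
  have "bij_betw \<Phi> (twisted_coxeter_elements n) (twisted_adapted_cluster_point n)"
    unfolding bij_betw_def elements cluster_eq
  proof
    show "inj_on \<Phi> (cox ` {w. twisted_word w})"
      using \<Phi> key by (auto intro!: inj_onI)
    show "\<Phi> ` cox ` {w. twisted_word w} = power_class ` {w. twisted_word w}"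
      using \<Phi> by (force simp: image_iff)
  qed
  moreover have "\<forall>w\<in>twisted_coxeter_words n.
      \<Phi> (word_prod n w \<circ> vee_map n) = comm_class n (twisted_power_word n w)"
  proof
    fix w assume "w \<in> twisted_coxeter_words n"
    then have "twisted_word w" by (simp only: twisted_word_iff)
    from \<Phi>[OF this] show "\<Phi> (word_prod n w \<circ> vee_map n) = comm_class n (twisted_power_word n w)"
      unfolding cox_def power_class_def twisted_power_word_blocks .
  qed
  ultimately show ?thesis using card_cluster by blast
qed

end
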